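(* Let $(\mathfrak g,[\cdot,\cdot],\theta)$ be a finite-dimensional simple (multiplicative) involutive Hom-Lie algebra over $\mathbb K$, and let $\mathfrak g_\theta=(\mathfrak g,[\cdot,\cdot]_\theta)$ be the Lie algebra with bracket $[x,y]_\theta=\theta([x,y])=[\theta(x),\theta(y)]$. Then $\mathfrak g_\theta$ is either a simple Lie algebra or a semisimple Lie algebra; moreover, in the second case it decomposes as $\mathfrak g_\theta=S\oplus\theta(S)$ where $S$ is a simple ideal of $\mathfrak g_\theta$. In addition, the form $B:\mathfrak g\times\mathfrak g\to\mathbb K$ defined by $B(x,y)=\mathrm{tr}(\rho(x)\rho(y))$, where $\rho(x)=[x,\cdot]$, defines a quadratic structure on $(\mathfrak g,[\cdot,\cdot],\theta)$, and $B(x,y)=\mathcal K(\theta(x),y)$ for all $x,y\in\mathfrak g$, where $\mathcal K$ is the Killing form of the Lie algebra $\mathfrak g_\theta$. Conversely, if $(\mathfrak g,[\cdot,\cdot])$ is a finite-dimensional simple Lie algebra over $\mathbb K$ and $\theta\in\mathrm{Aut}(\mathfrak g)$ is an involution, then $(\mathfrak g,\theta\circ[\cdot,\cdot],\theta)$ is a simple Hom-Lie algebra.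
   Context: $\mathbb K$ is an algebraically closed field of characteristic $0$. A Hom-Lie algebra is a triple $(\mathfrak g,[\cdot,\cdot],\alpha)$ with $[\cdot,\cdot]$ a skew-symmetric bilinear bracket and $\alpha$ a linear map such that $[\alpha(x),[y,z]]+[\alpha(y),[z,x]]+[\alpha(z),[x,y]]=0$ for all $x,y,z$. It is multiplicative if $\alpha([x,y])=[\alpha(x),\alpha(y)]$ and involutive if $\alpha^2=\mathrm{id}$. An ideal is a subspace $I$ with $[I,\mathfrak g]\subseteq I$ and $\alpha(I)\subseteq I$. A Hom-Lie algebra is simple if its bracket is not identically zero and it has no ideals other than $\{0\}$ and itself. A bilinear form $B$ defines a quadratic structure on $(\mathfrak g,[\cdot,\cdot],\alpha)$ if it is symmetric, nondegenerate, invariant ($B([x,y],z)=B(x,[y,z])$) and satisfies $B(\alpha(x),y)=B(x,\alpha(y))$. An involution is a linear map with square the identity. *)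

theory Defs
  imports "HOL-Computational_Algebra.Polynomial"
begin

section \<open>Lie algebras\<close>

text \<open>
  A Lie algebra is carried by a subspace \<open>L\<close> of the ambient vector space, so that an ideal
  can itself be regarded as a Lie algebra. Taking \<open>L = UNIV\<close> makes the whole vector space
  a Lie algebra.
\<close>

locale lie_algebra = vector_space scale
  for scale :: "'k::field \<Rightarrow> 'v::ab_group_add \<Rightarrow> 'v" (infixr \<open>*s\<close> 75) +
  fixes L :: "'v set"
    and br :: "'v \<Rightarrow> 'v \<Rightarrow> 'v"
  assumes subspace_carrier: "subspace L"
    and br_closed: "x \<in> L \<Longrightarrow> y \<in> L \<Longrightarrow> br x y \<in> L"
    and br_add_left: "x \<in> L \<Longrightarrow> y \<in> L \<Longrightarrow> z \<in> L \<Longrightarrow> br (x + y) z = br x z + br y z"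
    and br_add_right: "x \<in> L \<Longrightarrow> y \<in> L \<Longrightarrow> z \<in> L \<Longrightarrow> br x (y + z) = br x y + br x z"
    and br_scale_left: "x \<in> L \<Longrightarrow> y \<in> L \<Longrightarrow> br (c *s x) y = c *s br x y"
    and br_scale_right: "x \<in> L \<Longrightarrow> y \<in> L \<Longrightarrow> br x (c *s y) = c *s br x y"
    and br_self: "x \<in> L \<Longrightarrow> br x x = 0"
    and jacobi: "x \<in> L \<Longrightarrow> y \<in> L \<Longrightarrow> z \<in> L \<Longrightarrow>
      br x (br y z) + br y (br z x) + br z (br x y) = 0"
begin

definition ideal :: "'v set \<Rightarrow> bool" where
  "ideal I \<longleftrightarrow> subspace I \<and> I \<subseteq> L \<and> (\<forall>x\<in>I. \<forall>y\<in>L. br x y \<in> I)"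

definition derived :: "'v set \<Rightarrow> 'v set" where
  "derived I = span {br x y | x y. x \<in> I \<and> y \<in> I}"

definition solvable :: "'v set \<Rightarrow> bool" where
  "solvable I \<longleftrightarrow> (\<exists>n. (derived ^^ n) I = {0})"

definition direct_sum_of_ideals :: "'v set \<Rightarrow> 'v set \<Rightarrow> bool" where
  "direct_sum_of_ideals I J \<longleftrightarrow>
     ideal I \<and> ideal J \<and> I \<inter> J = {0} \<and> L = {x + y | x y. x \<in> I \<and> y \<in> J}"

end

locale simple_lie_algebra = lie_algebra +
  assumes nonabelian: "\<exists>x\<in>L. \<exists>y\<in>L. br x y \<noteq> 0"
    and no_proper_ideal: "ideal I \<Longrightarrow> I = {0} \<or> I = L"

text \<open>In finite dimension, the assumption says that the radical vanishes.\<close>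

locale semisimple_lie_algebra = lie_algebra +
  assumes no_solvable_ideal: "ideal I \<Longrightarrow> solvable I \<Longrightarrow> I = {0}"

definition lie_automorphism ::
    "('k::field \<Rightarrow> 'v::ab_group_add \<Rightarrow> 'v) \<Rightarrow> ('v \<Rightarrow> 'v \<Rightarrow> 'v) \<Rightarrow> ('v \<Rightarrow> 'v) \<Rightarrow> bool" where
  "lie_automorphism scale br \<phi> \<longleftrightarrow>
     Vector_Spaces.linear scale scale \<phi> \<and> bij \<phi> \<and> (\<forall>x y. \<phi> (br x y) = br (\<phi> x) (\<phi> y))"


section \<open>Hom-Lie algebras\<close>

locale hom_lie_algebra = vector_space scale
  for scale :: "'k::field \<Rightarrow> 'v::ab_group_add \<Rightarrow> 'v" (infixr \<open>*s\<close> 75) +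
  fixes br :: "'v \<Rightarrow> 'v \<Rightarrow> 'v"
    and \<alpha> :: "'v \<Rightarrow> 'v"
  assumes linear_br_left: "Vector_Spaces.linear scale scale (\<lambda>x. br x y)"
    and linear_br_right: "Vector_Spaces.linear scale scale (\<lambda>y. br x y)"
    and br_skew: "br x y = - br y x"
    and linear_twist: "Vector_Spaces.linear scale scale \<alpha>"
    and hom_jacobi: "br (\<alpha> x) (br y z) + br (\<alpha> y) (br z x) + br (\<alpha> z) (br x y) = 0"
begin

definition ideal :: "'v set \<Rightarrow> bool" where
  "ideal I \<longleftrightarrow> subspace I \<and> (\<forall>x\<in>I. \<forall>y. br x y \<in> I) \<and> \<alpha> ` I \<subseteq> I"

end

locale simple_hom_lie_algebra = hom_lie_algebra +
  assumes br_nonzero: "\<exists>x y. br x y \<noteq> 0"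
    and no_proper_ideal: "ideal I \<Longrightarrow> I = {0} \<or> I = UNIV"

locale multiplicative_hom_lie_algebra = hom_lie_algebra +
  assumes multiplicative: "\<alpha> (br x y) = br (\<alpha> x) (\<alpha> y)"

locale involutive_hom_lie_algebra = hom_lie_algebra +
  assumes involutive: "\<alpha> (\<alpha> x) = x"

definition quadratic_structure ::
    "('k::field \<Rightarrow> 'v::ab_group_add \<Rightarrow> 'v) \<Rightarrow> ('v \<Rightarrow> 'v \<Rightarrow> 'v) \<Rightarrow> ('v \<Rightarrow> 'v) \<Rightarrow>
      ('v \<Rightarrow> 'v \<Rightarrow> 'k) \<Rightarrow> bool" where
  "quadratic_structure scale br \<alpha> B \<longleftrightarrow>
     (\<forall>y. Vector_Spaces.linear scale (*) (\<lambda>x. B x y)) \<and>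
     (\<forall>x. Vector_Spaces.linear scale (*) (\<lambda>y. B x y)) \<and>
     (\<forall>x y. B x y = B y x) \<and>
     (\<forall>x. (\<forall>y. B x y = 0) \<longrightarrow> x = 0) \<and>
     (\<forall>x y z. B (br x y) z = B x (br y z)) \<and>
     (\<forall>x y. B (\<alpha> x) y = B x (\<alpha> y))"


section \<open>Traces\<close>

context finite_dimensional_vector_space
begin

text \<open>
  The trace of a linear endomorphism, as the sum of the diagonal entries of its matrix with
  respect to \<open>Basis\<close>; for linear \<open>f\<close> the value does not depend on the choice of \<open>Basis\<close>.
\<close>

definition endo_trace :: "('b \<Rightarrow> 'b) \<Rightarrow> 'a" where
  "endo_trace f = (\<Sum>b\<in>Basis. representation Basis (f b) b)"

definition killing_form :: "('b \<Rightarrow> 'b \<Rightarrow> 'b) \<Rightarrow> 'b \<Rightarrow> 'b \<Rightarrow> 'a" where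
  "killing_form br x y = endo_trace (br x \<circ> br y)"

end

end

theory Submission
  imports Defs
begin

text \<open>
  Let \<open>S\<close> be a minimal nonzero ideal of \<open>\<gg>\<^sub>\<theta>\<close>. The sum \<open>S + \<theta>(S)\<close> is a \<open>\<theta>\<close>-stable ideal, hence
  everything, and \<open>S \<inter> \<theta>(S)\<close> is \<open>S\<close> or \<open>0\<close>, which gives the two cases. The radical of the Killing
  form of \<open>\<gg>\<^sub>\<theta>\<close> is also a \<open>\<theta>\<close>-stable ideal, so nondegeneracy reduces to the Killing form being
  nonzero. That is a weak form of Cartan's criterion: suppose the Killing form of a perfect Lie algebra
  vanishes. Given \<open>x\<close> and a \<open>\<rat>\<close>-linear functional \<open>f\<close> on the field, let \<open>D\<close> act by \<open>f(\<lambda>)\<close> on the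
  generalized \<open>\<lambda>\<close>-eigenspace of \<open>ad x\<close>. It is a derivation, so writing \<open>x\<close> as a sum of brackets
  gives \<open>tr (ad x \<circ> D) = 0\<close>. This is a relation \<open>\<Sum> \<lambda> f(\<lambda>) = 0\<close>, and \<open>f\<close> turns it into
  \<open>\<Sum> f(\<lambda>)\<^sup>2 = 0\<close>. Hence every \<open>ad x\<close> is nilpotent, contradicting Engel's theorem.
\<close>

subsection \<open>Traces\<close>

lemma linear_funpow:
  assumes "Vector_Spaces.linear s s f"
  shows "Vector_Spaces.linear s s (f ^^ n)"
proof (induction n)
  case 0
  interpret Vector_Spaces.linear s s f by (rule assms)
  show ?case by (simp add: vs1.linear_id[unfolded id_def] id_def)
next
  case (Suc n)
  then show ?case
    using Vector_Spaces.linear_compose[OF Suc assms] by (simp add: comp_def)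
qed

context finite_dimensional_vector_space
begin

interpretation endo: vector_space_pair scale scale
  by unfold_locales

text \<open>Basis independence of the trace: expand \<open>f b\<close> through the coordinates of
  \<open>b\<close> in \<open>C\<close>, exchange the two sums, and collapse the inner sum by
  expanding \<open>f c\<close> in \<open>Basis\<close>.\<close>

lemma endo_trace_eq_sum_representation:
  assumes C: "independent C" "span C = UNIV"
    and f: "Vector_Spaces.linear scale scale f"
  shows "endo_trace f = (\<Sum>c\<in>C. representation C (f c) c)"
proof -
  have finC: "finite C"
    using C(1) by (rule finiteI_independent)
  have expand: "f b = (\<Sum>c\<in>C. representation C b c *s f c)" for b
  proof -
    have "f b = f (\<Sum>c\<in>C. representation C b c *s c)"
      using sum_representation_eq[of C b C] C finC by simp
    then show ?thesis
      by (simp add: endo.linear_sum[OF f] endo.linear_scale[OF f])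
  qed
  have "endo_trace f = (\<Sum>b\<in>Basis. \<Sum>c\<in>C. representation C b c * representation Basis (f c) b)"
    unfolding endo_trace_def
  proof (rule sum.cong[OF refl])
    fix b assume "b \<in> Basis"
    show "representation Basis (f b) b = (\<Sum>c\<in>C. representation C b c * representation Basis (f c) b)"
      by (subst expand) (simp add: representation_sum representation_scale independent_Basis span_Basis)
  qed
  also have "\<dots> = (\<Sum>c\<in>C. \<Sum>b\<in>Basis. representation Basis (f c) b * representation C b c)"
    by (subst sum.swap) (simp add: mult.commute)
  also have "\<dots> = (\<Sum>c\<in>C. representation C (f c) c)"
  proof (rule sum.cong[OF refl])
    fix c assume "c \<in> C"
    have "representation C (f c) c = representation C (\<Sum>b\<in>Basis. representation Basis (f c) b *s b) c"
      using sum_representation_eq[of Basis "f c" Basis] independent_Basis span_Basis finite_Basis by simp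
    also have "\<dots> = (\<Sum>b\<in>Basis. representation Basis (f c) b * representation C b c)"
      using C by (simp add: representation_sum representation_scale)
    finally show "(\<Sum>b\<in>Basis. representation Basis (f c) b * representation C b c) = representation C (f c) c"
      by simp
  qed
  finally show ?thesis .
qed

text \<open>Both traces are the same double sum of products of matrix entries, taken in the two
  orders of summation.\<close>

lemma endo_trace_comp_commute:
  assumes f: "Vector_Spaces.linear scale scale f" and g: "Vector_Spaces.linear scale scale g"
  shows "endo_trace (f \<circ> g) = endo_trace (g \<circ> f)"
proof -
  let ?r = "representation Basis"
  have entries: "endo_trace (f \<circ> g) = (\<Sum>b\<in>Basis. \<Sum>c\<in>Basis. ?r (g b) c * ?r (f c) b)"
    if f: "Vector_Spaces.linear scale scale f" for f g
    unfolding endo_trace_def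
  proof (rule sum.cong[OF refl])
    fix b assume "b \<in> Basis"
    have "f (g b) = f (\<Sum>c\<in>Basis. ?r (g b) c *s c)"
      using sum_representation_eq[of Basis "g b" Basis] independent_Basis span_Basis finite_Basis by simp
    also have "\<dots> = (\<Sum>c\<in>Basis. ?r (g b) c *s f c)"
      by (simp add: endo.linear_sum[OF f] endo.linear_scale[OF f])
    finally show "?r ((f \<circ> g) b) b = (\<Sum>c\<in>Basis. ?r (g b) c * ?r (f c) b)"
      by (simp add: representation_sum representation_scale independent_Basis span_Basis)
  qed
  have "endo_trace (f \<circ> g) = (\<Sum>c\<in>Basis. \<Sum>b\<in>Basis. ?r (g b) c * ?r (f c) b)"
    unfolding entries[OF f] by (rule sum.swap)
  also have "\<dots> = endo_trace (g \<circ> f)"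
    unfolding entries[OF g] by (simp add: mult.commute)
  finally show ?thesis .
qed

lemma endo_trace_add: "endo_trace (\<lambda>v. f v + g v) = endo_trace f + endo_trace g"
  by (simp add: endo_trace_def representation_add independent_Basis span_Basis sum.distrib)

lemma endo_trace_diff: "endo_trace (\<lambda>v. f v - g v) = endo_trace f - endo_trace g"
  by (simp add: endo_trace_def representation_diff independent_Basis span_Basis sum_subtractf)

lemma endo_trace_scale: "endo_trace (\<lambda>v. c *s f v) = c * endo_trace f"
  by (simp add: endo_trace_def representation_scale independent_Basis span_Basis sum_distrib_left)

text \<open>
  A basis adapted to the chain of the kernels of the powers of \<open>N\<close> makes \<open>N\<close> strictly triangular.
\<close>

lemma endo_trace_nilpotent:
  assumes N: "Vector_Spaces.linear scale scale N" and nil: "\<And>v. (N ^^ n) v = 0"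
  shows "endo_trace N = 0"
proof -
  define K where "K j = {v. (N ^^ j) v = 0}" for j
  have K_mono: "K j \<subseteq> K (Suc j)" for j
    by (auto simp: K_def endo.linear_0[OF N])
  have K_step: "N v \<in> K j" if "v \<in> K (Suc j)" for v j
    using that by (simp add: K_def funpow_swap1)
  have subK: "subspace (K j)" for j
    unfolding K_def by (rule endo.linear_subspace_kernel[OF linear_funpow[OF N]])
  have "\<exists>C. independent C \<and> span C = K j \<and> (\<forall>c\<in>C. representation C (N c) c = 0)" for j
  proof (induction j)
    case 0
    show ?case
      by (rule exI[of _ "{}"]) (auto simp: K_def independent_empty)
  next
    case (Suc j)
    then obtain C where C: "independent C" "span C = K j" "\<And>c. c \<in> C \<Longrightarrow> representation C (N c) c = 0"
      by blast
    have "C \<subseteq> K (Suc j)"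
      using C(2) K_mono span_superset by blast
    then obtain C' where C': "C \<subseteq> C'" "C' \<subseteq> K (Suc j)" "independent C'" "K (Suc j) \<subseteq> span C'"
      using C(1) by (rule maximal_independent_subset_extend)
    have "span C' = K (Suc j)"
      using C' subK by (metis span_subspace)
    moreover have "representation C' (N c) c = 0" if c: "c \<in> C'" for c
    proof -
      \<comment> \<open>Coordinates of \<open>N c\<close> involve only the old basis
        \<open>C\<close>, so the diagonal entry is inherited at old vectors and is 0 at new
        ones.\<close>
      have "N c \<in> span C"
        using c C'(2) K_step C(2) by blast
      then have eq: "representation C' (N c) = representation C (N c)"
        using C'(1,3) by (intro representation_extend)
      show ?thesis
      proof (cases "c \<in> C")
        case True
        then show ?thesis using eq C(3) by simp
      next
        case False
        then show ?thesis using eq representation_ne_zero by metis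
      qed
    qed
    ultimately show ?case using C'(3) by blast
  qed
  then obtain C where C: "independent C" "span C = K n" "\<And>c. c \<in> C \<Longrightarrow> representation C (N c) c = 0"
    by blast
  have "K n = UNIV"
    using nil by (auto simp: K_def)
  then show ?thesis
    using endo_trace_eq_sum_representation[OF C(1) _ N] C by simp
qed

text \<open>The vectors killed by some power of \<open>N\<close> form a subspace, so it is
  everything; finiteness of the basis then makes the exponent uniform.\<close>

lemma locally_nilpotent_imp_nilpotent:
  assumes N: "Vector_Spaces.linear scale scale N"
    and S: "span S = UNIV" and nil: "\<And>v. v \<in> S \<Longrightarrow> \<exists>n. (N ^^ n) v = 0"
  shows "\<exists>n. \<forall>v. (N ^^ n) v = 0"
proof -
  have lift: "(N ^^ n) v = 0" if "(N ^^ m) v = 0" "m \<le> n" for m n v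
    using that(1) endo.linear_0[OF linear_funpow[OF N]]
    by (metis that(2) le_add_diff_inverse2 comp_apply funpow_add)
  have sub: "subspace {v. \<exists>n. (N ^^ n) v = 0}"
  proof (rule subspaceI)
    show "0 \<in> {v. \<exists>n. (N ^^ n) v = 0}"
      by (auto intro: exI[of _ 0])
    fix v w assume "v \<in> {v. \<exists>n. (N ^^ n) v = 0}" "w \<in> {v. \<exists>n. (N ^^ n) v = 0}"
    then obtain m n where "(N ^^ m) v = 0" "(N ^^ n) w = 0" by blast
    then have "(N ^^ max m n) (v + w) = 0"
      by (simp add: endo.linear_add[OF linear_funpow[OF N]] lift)
    then show "v + w \<in> {v. \<exists>n. (N ^^ n) v = 0}" by blast
  next
    fix c v assume "v \<in> {v. \<exists>n. (N ^^ n) v = 0}"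
    then show "c *s v \<in> {v. \<exists>n. (N ^^ n) v = 0}"
      by (auto simp: endo.linear_scale[OF linear_funpow[OF N]])
  qed
  have "span S \<subseteq> {v. \<exists>n. (N ^^ n) v = 0}"
    using nil by (intro span_minimal[OF _ sub]) blast
  then have all: "\<exists>n. (N ^^ n) v = 0" for v
    using S by blast
  define k where "k v = (LEAST n. (N ^^ n) v = 0)" for v
  have k: "(N ^^ k v) v = 0" for v
    unfolding k_def using all by (rule LeastI_ex)
  \<comment> \<open>The sum bounds each \<open>k b\<close>, so it serves as a common exponent on the
    basis.\<close>
  define m where "m = (\<Sum>b\<in>Basis. k b)"
  have "(N ^^ m) b = 0" if "b \<in> Basis" for b
    using k by (rule lift) (simp add: m_def finite_Basis member_le_sum that)
  then have "(N ^^ m) v = 0" for v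
    using endo.linear_eq_0_on_span[OF linear_funpow[OF N]] span_Basis by blast
  then show ?thesis by blast
qed

end

subsection \<open>Generalized eigenspaces\<close>

locale endomorphism = vector_space scale
  for scale :: "'k::field \<Rightarrow> 'v::ab_group_add \<Rightarrow> 'v" (infixr \<open>*s\<close> 75) +
  fixes T :: "'v \<Rightarrow> 'v"
  assumes T: "Vector_Spaces.linear scale scale T"
begin

interpretation endo: vector_space_pair scale scale
  by unfold_locales

definition shift :: "'k \<Rightarrow> 'v \<Rightarrow> 'v" where
  "shift l v = T v - l *s v"

definition gen_eigenspace :: "'k \<Rightarrow> 'v set" where
  "gen_eigenspace l = {v. \<exists>k. (shift l ^^ k) v = 0}"

lemma linear_shift:
  shows "Vector_Spaces.linear scale scale (shift l)"
  unfolding shift_def[abs_def]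
  by (intro endo.linear_compose_sub T endo.linear_compose_scale_right linear_ident)

lemma shift_funpow_commute:
  shows "(shift l ^^ k) (shift m v) = shift m ((shift l ^^ k) v)"
proof (induction k)
  case (Suc k)
  have "shift l (shift m w) = shift m (shift l w)" for w
    by (simp add: shift_def endo.linear_diff[OF T] endo.linear_scale[OF T] algebra_simps)
  then show ?case using Suc by simp
qed simp

lemma funpow_shift_lift:
  assumes "(shift l ^^ j) v = 0" "j \<le> k"
  shows "(shift l ^^ k) v = 0"
  using assms endo.linear_0[OF linear_funpow[OF linear_shift]]
  by (metis le_add_diff_inverse2 comp_apply funpow_add)

lemma subspace_gen_eigenspace:
  shows "subspace (gen_eigenspace l)"
proof (rule subspaceI)
  show "0 \<in> gen_eigenspace l"
    unfolding gen_eigenspace_def by (auto intro: exI[of _ 0])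
  fix v w assume "v \<in> gen_eigenspace l" "w \<in> gen_eigenspace l"
  then obtain m n where "(shift l ^^ m) v = 0" "(shift l ^^ n) w = 0"
    unfolding gen_eigenspace_def by blast
  then have "(shift l ^^ max m n) (v + w) = 0"
    by (simp add: endo.linear_add[OF linear_funpow[OF linear_shift]] funpow_shift_lift)
  then show "v + w \<in> gen_eigenspace l" unfolding gen_eigenspace_def by blast
next
  fix c v assume "v \<in> gen_eigenspace l"
  then show "c *s v \<in> gen_eigenspace l"
    by (auto simp: gen_eigenspace_def endo.linear_scale[OF linear_funpow[OF linear_shift]])
qed

lemma shift_in_gen_eigenspace:
  assumes "v \<in> gen_eigenspace l"
  shows "shift m v \<in> gen_eigenspace l"
  using assms endo.linear_0[OF linear_shift]
  unfolding gen_eigenspace_def by (auto simp: shift_funpow_commute) metis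

lemma funpow_shift_in_gen_eigenspace:
  assumes "v \<in> gen_eigenspace l"
  shows "(shift m ^^ k) v \<in> gen_eigenspace l"
  by (induction k) (auto intro: shift_in_gen_eigenspace assms(1))

text \<open>On an eigenvector for \<open>l\<close>, \<open>shift m\<close> is multiplication by the
  nonzero scalar \<open>l - m\<close>, and some power of it kills \<open>v\<close>.\<close>

lemma shift_eq_0_gen_eigenspace:
  assumes v: "v \<in> gen_eigenspace m" "shift l v = 0" and "l \<noteq> m"
  shows "v = 0"
proof -
  have pow: "(shift m ^^ k) v = (l - m) ^ k *s v" for k
  proof (induction k)
    case (Suc k)
    have "shift m v = (l - m) *s v"
      using v(2) by (simp add: shift_def algebra_simps)
    then show ?case
      using Suc by (simp add: endo.linear_scale[OF linear_shift] mult.commute)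
  qed simp
  obtain k where "(shift m ^^ k) v = 0"
    using v(1) unfolding gen_eigenspace_def by blast
  then show ?thesis
    using \<open>l \<noteq> m\<close> by (simp add: pow)
qed

text \<open>\<open>shift l\<close> preserves \<open>gen_eigenspace m\<close> and is injective there,
  so its powers can be peeled off \<open>v\<close> one at a time.\<close>

lemma gen_eigenspace_disjoint:
  assumes "v \<in> gen_eigenspace m" "v \<in> gen_eigenspace l" "l \<noteq> m"
  shows "v = 0"
proof -
  have "(shift l ^^ k) v = 0 \<Longrightarrow> v = 0" for k
  proof (induction k)
    case (Suc k)
    have "(shift l ^^ k) v = 0"
      by (rule shift_eq_0_gen_eigenspace[OF funpow_shift_in_gen_eigenspace[OF assms(1)] _ assms(3)])
        (use Suc.prems in simp)
    then show ?case by (rule Suc.IH)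
  qed simp
  then show ?thesis using assms(2) unfolding gen_eigenspace_def by blast
qed

text \<open>A power of \<open>shift m\<close> removes the component at \<open>m\<close>. The
  induction hypothesis then shows that the same power kills every other \<open>v j\<close>, which
  therefore lies in two generalized eigenspaces.\<close>

lemma gen_eigenspaces_independent:
  assumes "finite F"
  shows "(\<And>l. l \<in> F \<Longrightarrow> v l \<in> gen_eigenspace l) \<Longrightarrow> (\<Sum>l\<in>F. v l) = 0 \<Longrightarrow> l \<in> F \<Longrightarrow> v l = 0"
  using assms(1)
proof (induction F arbitrary: v l rule: finite_induct)
  case (insert m F)
  obtain k where k: "(shift m ^^ k) (v m) = 0"
    using insert.prems(1)[of m] unfolding gen_eigenspace_def by blast
  have "0 = (shift m ^^ k) (\<Sum>l\<in>insert m F. v l)"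
    by (simp add: insert.prems(2) endo.linear_0[OF linear_funpow[OF linear_shift]])
  also have "\<dots> = (\<Sum>l\<in>F. (shift m ^^ k) (v l))"
    using insert.hyps k
    by (simp add: endo.linear_add[OF linear_funpow[OF linear_shift]]
        endo.linear_sum[OF linear_funpow[OF linear_shift]])
  finally have sum0: "(\<Sum>l\<in>F. (shift m ^^ k) (v l)) = 0" by simp
  have F0: "v j = 0" if "j \<in> F" for j
  proof -
    have "(shift m ^^ k) (v j) = 0"
    proof (rule insert.IH[OF _ sum0 that])
      show "(shift m ^^ k) (v i) \<in> gen_eigenspace i" if "i \<in> F" for i
        using insert.prems(1)[of i] that by (intro funpow_shift_in_gen_eigenspace) simp
    qed
    then have "v j \<in> gen_eigenspace m"
      unfolding gen_eigenspace_def by blast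
    moreover have "m \<noteq> j" using insert.hyps that by blast
    ultimately show ?thesis
      using gen_eigenspace_disjoint[OF insert.prems(1)[of j]] that by blast
  qed
  then have "v m = 0"
    using insert.prems(2) insert.hyps by simp
  then show ?case using F0 insert.prems(3) by auto
qed simp

text \<open>\<open>shift l\<close> is \<open>shift m\<close> plus the nonzero scalar
  \<open>m - l\<close>, that is, a locally nilpotent map plus an invertible scalar. The preimage is
  built by induction on the nilpotency exponent of \<open>w\<close>.\<close>

lemma shift_onto_gen_eigenspace:
  assumes "l \<noteq> m" and "w \<in> gen_eigenspace m"
  shows "\<exists>u\<in>gen_eigenspace m. shift l u = w"
proof -
  have "(shift m ^^ k) w = 0 \<Longrightarrow> \<exists>u\<in>gen_eigenspace m. shift l u = w" for k w
  proof (induction k arbitrary: w)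
    case 0
    then show ?case
      by (intro bexI[of _ 0]) (auto simp: endo.linear_0[OF linear_shift] gen_eigenspace_def intro: exI[of _ 0])
  next
    case (Suc k)
    have w: "w \<in> gen_eigenspace m"
      using Suc.prems unfolding gen_eigenspace_def by blast
    obtain u where u: "u \<in> gen_eigenspace m" "shift l u = shift m w"
      using Suc.IH[of "shift m w"] Suc.prems by (auto simp: funpow_swap1)
    \<comment> \<open>As \<open>shift l w = shift m w + (m - l) *s w\<close>, subtracting the
      preimage \<open>u\<close> of \<open>shift m w\<close> leaves just
      \<open>(m - l) *s w\<close>.\<close>
    have "shift l (inverse (m - l) *s (w - u)) = inverse (m - l) *s (shift l w - shift m w)"
      by (simp add: endo.linear_scale[OF linear_shift] endo.linear_diff[OF linear_shift] u(2))
    also have "shift l w - shift m w = (m - l) *s w"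
      by (simp add: shift_def algebra_simps)
    finally have "shift l (inverse (m - l) *s (w - u)) = w"
      using \<open>l \<noteq> m\<close> by simp
    moreover have "inverse (m - l) *s (w - u) \<in> gen_eigenspace m"
      by (intro subspace_scale subspace_diff subspace_gen_eigenspace w u(1))
    ultimately show ?case by blast
  qed
  then show ?thesis using assms(2) unfolding gen_eigenspace_def by blast
qed

text \<open>Every vector of the span is \<open>shift l u + w'\<close> with \<open>u\<close> in the
  span and \<open>w'\<close> in \<open>gen_eigenspace l\<close>, because \<open>shift l\<close> is
  onto each of the other generalized eigenspaces. Applied to \<open>shift l v\<close>, this makes
  \<open>v - u\<close> a generalized eigenvector for \<open>l\<close>.\<close>

lemma shift_in_span_gen_eigenspaces:
  assumes "shift l v \<in> span (\<Union>m. gen_eigenspace m)"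
  shows "v \<in> span (\<Union>m. gen_eigenspace m)"
proof -
  let ?U = "span (\<Union>m. gen_eigenspace m)"
  have "\<exists>u\<in>?U. \<exists>w'\<in>gen_eigenspace l. w = shift l u + w'" if "w \<in> ?U" for w
    using that
  proof (induction w rule: span_induct_alt)
    case base
    show ?case
      by (rule bexI[of _ 0], rule bexI[of _ 0])
        (auto simp: endo.linear_0[OF linear_shift] span_zero subspace_0 subspace_gen_eigenspace)
  next
    case (step c x y)
    obtain u w' where y: "u \<in> ?U" "w' \<in> gen_eigenspace l" "y = shift l u + w'"
      using step by blast
    obtain m where x: "x \<in> gen_eigenspace m"
      using step by blast
    show ?case
    proof (cases "l = m")
      case True
      then have "c *s x + w' \<in> gen_eigenspace l"
        using x y(2) by (intro subspace_add subspace_scale subspace_gen_eigenspace) auto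
      then show ?thesis
        using y by (intro bexI[of _ u] bexI[of _ "c *s x + w'"]) (auto simp: algebra_simps)
    next
      case False
      then obtain t where t: "t \<in> gen_eigenspace m" "shift l t = x"
        using shift_onto_gen_eigenspace[OF _ x] by blast
      have "c *s t + u \<in> ?U"
        using t(1) y(1) by (intro span_add span_scale) (auto intro: span_base)
      then show ?thesis
        using y t by (intro bexI[of _ "c *s t + u"] bexI[of _ w'])
          (auto simp: endo.linear_add[OF linear_shift] endo.linear_scale[OF linear_shift] algebra_simps)
    qed
  qed
  then obtain u w' where u: "u \<in> ?U" "w' \<in> gen_eigenspace l" "shift l v = shift l u + w'"
    using assms(1) by blast
  then have "shift l (v - u) \<in> gen_eigenspace l"
    by (simp add: endo.linear_diff[OF linear_shift])
  then obtain k where "(shift l ^^ k) (shift l (v - u)) = 0"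
    unfolding gen_eigenspace_def by blast
  then have "(shift l ^^ Suc k) (v - u) = 0"
    by (simp add: funpow_swap1)
  then have "v - u \<in> gen_eigenspace l"
    unfolding gen_eigenspace_def by blast
  then have "(v - u) + u \<in> ?U"
    using u(1) by (intro span_add) (auto intro: span_base)
  then show ?thesis by simp
qed

section \<open>Annihilating polynomials and the span of the generalized eigenspaces\<close>

definition poly_apply :: "'k poly \<Rightarrow> 'v \<Rightarrow> 'v" where
  "poly_apply p v = (\<Sum>i\<le>degree p. coeff p i *s (T ^^ i) v)"

lemma poly_apply_eq_sum:
  assumes "degree p \<le> n"
  shows "poly_apply p v = (\<Sum>i\<le>n. coeff p i *s (T ^^ i) v)"
  unfolding poly_apply_def
  by (rule sum.mono_neutral_left) (use assms in \<open>auto simp: coeff_eq_0 not_le\<close>)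

text \<open>Splitting off a root trades one degree of the polynomial for one \<open>shift\<close>,
  which drives the induction in \<open>span_gen_eigenspaces\<close>.\<close>

lemma poly_apply_linear_factor:
  shows "poly_apply ([:-l, 1:] * q) v = poly_apply q (shift l v)"
proof -
  let ?n = "degree q"
  have "degree ([:-l, 1:] * q) \<le> Suc ?n"
    using degree_mult_le[of "[:-l, 1:]" q] by simp
  then have "poly_apply ([:-l, 1:] * q) v = (\<Sum>i\<le>Suc ?n. coeff ([:-l, 1:] * q) i *s (T ^^ i) v)"
    by (rule poly_apply_eq_sum)
  also have "\<dots> = (\<Sum>i\<le>Suc ?n. coeff (pCons 0 q) i *s (T ^^ i) v) - (\<Sum>i\<le>Suc ?n. (l * coeff q i) *s (T ^^ i) v)"
    by (simp add: algebra_simps sum_subtractf del: sum.atMost_Suc)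
  also have "(\<Sum>i\<le>Suc ?n. coeff (pCons 0 q) i *s (T ^^ i) v) = (\<Sum>i\<le>?n. coeff q i *s (T ^^ i) (T v))"
    by (subst sum.atMost_Suc_shift) (simp add: funpow_swap1)
  also have "(\<Sum>i\<le>Suc ?n. (l * coeff q i) *s (T ^^ i) v) = (\<Sum>i\<le>?n. coeff q i *s (T ^^ i) (l *s v))"
    by (simp add: coeff_eq_0 endo.linear_scale[OF linear_funpow[OF T]] mult.commute)
  finally show ?thesis
    by (simp add: poly_apply_def shift_def endo.linear_diff[OF linear_funpow[OF T]] sum_subtractf algebra_simps)
qed

end

locale fd_endomorphism = finite_dimensional_vector_space scale Basis + endomorphism scale T
  for scale :: "'k::field \<Rightarrow> 'v::ab_group_add \<Rightarrow> 'v" (infixr \<open>*s\<close> 75)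
    and Basis :: "'v set" and T :: "'v \<Rightarrow> 'v"

text \<open>The iterates of \<open>v\<close> with exponents up to \<open>dimension\<close> are one
  too many to be independent; a linear relation among them is the polynomial.\<close>

lemma (in fd_endomorphism) ex_annihilating_poly:
  "\<exists>p. p \<noteq> 0 \<and> poly_apply p v = 0"
proof (cases "inj_on (\<lambda>i. (T ^^ i) v) {..dimension}")
  case True
  let ?A = "(\<lambda>i. (T ^^ i) v) ` {..dimension}"
  have "card ?A > dim UNIV"
    using True by (simp add: card_image dim_UNIV dimension_def)
  then have "dependent ?A"
    using independent_card_le_dim[of ?A UNIV] by auto
  then obtain u w where u: "w \<in> ?A" "u w \<noteq> 0" "(\<Sum>w\<in>?A. u w *s w) = 0"
    using dependent_finite[of ?A] by auto
  define p where "p = Poly (map (\<lambda>i. u ((T ^^ i) v)) [0..<Suc dimension])"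
  have coeff_p: "coeff p i = (if i \<le> dimension then u ((T ^^ i) v) else 0)" for i
    by (auto simp: p_def nth_default_def simp del: upt_Suc)
  have "degree p \<le> dimension"
    by (rule degree_le) (simp add: coeff_p)
  then have "poly_apply p v = (\<Sum>i\<le>dimension. u ((T ^^ i) v) *s (T ^^ i) v)"
    by (simp add: poly_apply_eq_sum coeff_p)
  also have "\<dots> = 0"
    using u(3) True by (simp add: sum.reindex)
  finally have "poly_apply p v = 0" .
  moreover obtain i where "i \<le> dimension" "w = (T ^^ i) v" using u(1) by auto
  then have "coeff p i \<noteq> 0" using u(2) by (simp add: coeff_p)
  then have "p \<noteq> 0" by auto
  ultimately show ?thesis by blast
next
  \<comment> \<open>Dependence is a property of sets and does not see repetitions, so coinciding
    iterates are treated apart, by a difference of two monomials.\<close>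
  case False
  then obtain i j where ij: "i < j" "(T ^^ i) v = (T ^^ j) v"
    by (auto simp: inj_on_def) (metis linorder_neqE_nat)
  let ?p = "monom (1::'k) j - monom 1 i"
  have "coeff ?p j \<noteq> 0" using ij(1) by simp
  then have "?p \<noteq> 0" by (metis coeff_0)
  moreover have "degree ?p \<le> j"
    using ij(1) by (intro degree_le) auto
  then have "poly_apply ?p v = (\<Sum>k\<le>j. (if k = j then (T ^^ j) v else 0) - (if k = i then (T ^^ i) v else 0))"
    unfolding poly_apply_eq_sum[OF \<open>degree ?p \<le> j\<close>]
    by (intro sum.cong) auto
  then have "poly_apply ?p v = 0"
    using ij by (simp add: sum_subtractf)
  ultimately show ?thesis by blast
qed

locale alg_closed_endomorphism = fd_endomorphism scale Basis T
  for scale :: "'k::{alg_closed_field, field_char_0} \<Rightarrow> 'v::ab_group_add \<Rightarrow> 'v" (infixr \<open>*s\<close> 75)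
    and Basis :: "'v set" and T :: "'v \<Rightarrow> 'v"
begin

text \<open>Induction on the degree of a polynomial annihilating \<open>v\<close>. A root
  \<open>l\<close> exists by algebraic closedness, the cofactor annihilates
  \<open>shift l v\<close>, and \<open>shift_in_span_gen_eigenspaces\<close> leads back to
  \<open>v\<close>.\<close>

lemma span_gen_eigenspaces:
  shows "span (\<Union>l. gen_eigenspace l) = UNIV"
proof -
  have "p \<noteq> 0 \<Longrightarrow> poly_apply p v = 0 \<Longrightarrow> v \<in> span (\<Union>l. gen_eigenspace l)" for p v
  proof (induction "degree p" arbitrary: p v)
    case 0
    then obtain a where "p = [:a:]" "a \<noteq> 0"
      by (metis degree_eq_zeroE pCons_0_0)
    then have "v = 0" using 0 by (simp add: poly_apply_def)
    then show ?case by (simp add: span_zero)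
  next
    case (Suc d)
    then obtain l where "poly p l = 0"
      using alg_closed_imp_poly_has_root[of p] by auto
    then obtain q where q: "p = [:-l, 1:] * q"
      by (metis poly_eq_0_iff_dvd dvdE)
    have "q \<noteq> 0" using Suc.prems q by auto
    moreover have "d = degree q"
      using Suc.hyps(2) \<open>q \<noteq> 0\<close> degree_mult_eq[of "[:-l, 1:]" q] by (simp add: q del: mult_pCons_left)
    moreover have "poly_apply q (shift l v) = 0"
      using Suc.prems(2) unfolding q poly_apply_linear_factor .
    ultimately have "shift l v \<in> span (\<Union>l. gen_eigenspace l)"
      using Suc.hyps(1) by blast
    then show ?case by (rule shift_in_span_gen_eigenspaces)
  qed
  then show ?thesis using ex_annihilating_poly by blast
qed

end

section \<open>Operators scalar on each generalized eigenspace, and a trace criterion for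
  nilpotency\<close>

context alg_closed_endomorphism
begin

interpretation endo: vector_space_pair scale scale
  by unfold_locales

lemma ex_adapted_basis:
  obtains C ev where "independent C" "span C = UNIV" "\<And>c. c \<in> C \<Longrightarrow> c \<in> gen_eigenspace (ev c)"
proof -
  obtain C where C: "C \<subseteq> (\<Union>l. gen_eigenspace l)" "independent C" "(\<Union>l. gen_eigenspace l) \<subseteq> span C"
    using maximal_independent_subset by blast
  have "span (\<Union>l. gen_eigenspace l) \<subseteq> span C"
    using C(3) by (intro span_minimal) auto
  then have "span C = UNIV"
    using span_gen_eigenspaces by auto
  moreover have "\<exists>ev. \<forall>c\<in>C. c \<in> gen_eigenspace (ev c)"
    using C(1) by (intro bchoice) blast
  ultimately show thesis using C(2) that by blast
qed

text \<open>By independence of the generalized eigenspaces, \<open>v\<close> involves only those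
  basis vectors \<open>c\<close> with \<open>ev c = l\<close>, and \<open>D\<close> multiplies all
  of these by the same scalar.\<close>

lemma grading_operator_on_gen_eigenspace:
  assumes C: "independent C" "span C = UNIV" "\<And>c. c \<in> C \<Longrightarrow> c \<in> gen_eigenspace (ev c)"
    and D: "Vector_Spaces.linear scale scale D" "\<And>c. c \<in> C \<Longrightarrow> D c = \<phi> (ev c) *s c"
    and v: "v \<in> gen_eigenspace l"
  shows "D v = \<phi> l *s v"
proof -
  have finC: "finite C"
    using C(1) by (rule finiteI_independent)
  let ?r = "representation C v"
  define part where "part m = (\<Sum>c | c \<in> C \<and> ev c = m. ?r c *s c)" for m
  have part: "part m \<in> gen_eigenspace m" for m
    unfolding part_def using C(3)
    by (auto intro!: subspace_sum subspace_scale subspace_gen_eigenspace)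
  \<comment> \<open>\<open>l\<close> need not be a value of \<open>ev\<close> on \<open>C\<close>;
    in that case \<open>part l\<close> is an empty sum and the argument gives
    \<open>v = 0\<close>.\<close>
  let ?F = "insert l (ev ` C)"
  have v_sum: "v = (\<Sum>m\<in>?F. part m)"
  proof -
    have "v = (\<Sum>c\<in>C. ?r c *s c)"
      using sum_representation_eq[of C v C] C finC by simp
    also have "\<dots> = (\<Sum>m\<in>?F. part m)"
      unfolding part_def using finC by (intro sum.group[symmetric]) auto
    finally show ?thesis .
  qed
  have "part l - v = 0"
  proof -
    have "(\<Sum>m\<in>?F. part m - (if m = l then v else 0)) = 0"
      using finC by (simp only: sum_subtractf v_sum[symmetric]) simp
    then have "part l - (if l = l then v else 0) = 0"
      by (rule gen_eigenspaces_independent[rotated 2])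
        (use finC part v in \<open>auto intro: subspace_diff subspace_gen_eigenspace\<close>)
    then show ?thesis by simp
  qed
  then have v_eq: "v = part l" by simp
  have "D (part l) = (\<Sum>c | c \<in> C \<and> ev c = l. ?r c *s \<phi> l *s c)"
    unfolding part_def using D by (simp add: endo.linear_sum endo.linear_scale)
  also have "\<dots> = \<phi> l *s part l"
    by (simp add: part_def scale_sum_right mult.commute)
  finally show ?thesis using v_eq by simp
qed

text \<open>With the identity for \<open>\<phi>\<close> this yields the semisimple part of
  \<open>T\<close>; with an additive \<open>\<phi>\<close> and \<open>T = ad x\<close> it yields a
  derivation.\<close>

lemma ex_grading_operator:
  "\<exists>D. Vector_Spaces.linear scale scale D \<and> (\<forall>l. \<forall>v\<in>gen_eigenspace l. D v = \<phi> l *s v)"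
proof -
  obtain C ev where C: "independent C" "span C = UNIV" "\<And>c. c \<in> C \<Longrightarrow> c \<in> gen_eigenspace (ev c)"
    by (rule ex_adapted_basis) blast
  obtain D where "Vector_Spaces.linear scale scale D" "\<forall>c\<in>C. D c = \<phi> (ev c) *s c"
    using endo.linear_independent_extend[OF C(1), of "\<lambda>c. \<phi> (ev c) *s c"] by blast
  then show ?thesis
    using grading_operator_on_gen_eigenspace[OF C] by blast
qed

text \<open>
  The semisimple part \<open>A\<close> of \<open>T\<close> contributes the sum, and \<open>(T - A) \<circ> D\<close> is nilpotent, hence
  traceless.
\<close>

lemma endo_trace_comp_grading_operator:
  assumes C: "independent C" "span C = UNIV" "\<And>c. c \<in> C \<Longrightarrow> c \<in> gen_eigenspace (ev c)"
    and D: "Vector_Spaces.linear scale scale D" "\<And>l v. v \<in> gen_eigenspace l \<Longrightarrow> D v = \<phi> l *s v"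
  shows "endo_trace (T \<circ> D) = (\<Sum>c\<in>C. ev c * \<phi> (ev c))"
proof -
  obtain A where A: "Vector_Spaces.linear scale scale A" "\<And>l v. v \<in> gen_eigenspace l \<Longrightarrow> A v = l *s v"
    using ex_grading_operator[of "\<lambda>l. l"] by blast
  define N where "N v = T (D v) - A (D v)" for v
  have linN: "Vector_Spaces.linear scale scale N"
    unfolding N_def[abs_def]
    using endo.linear_compose_sub Vector_Spaces.linear_compose[OF D(1) T] Vector_Spaces.linear_compose[OF D(1) A(1)]
    by (simp add: comp_def)
  have "\<exists>n. \<forall>v. (N ^^ n) v = 0"
  proof (rule locally_nilpotent_imp_nilpotent[OF linN span_gen_eigenspaces])
    fix v assume "v \<in> (\<Union>l. gen_eigenspace l)"
    then obtain l where v: "v \<in> gen_eigenspace l" by blast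
    then obtain k where k: "(shift l ^^ k) v = 0"
      unfolding gen_eigenspace_def by blast
    \<comment> \<open>\<open>A\<close> and \<open>D\<close> are scalars on
      \<open>gen_eigenspace l\<close>, so \<open>N\<close> inherits local nilpotency from
      \<open>shift l\<close>.\<close>
    have N: "N w = \<phi> l *s shift l w" if "w \<in> gen_eigenspace l" for w
      using D(2)[OF that] A(2)[OF that]
      by (simp add: N_def shift_def endo.linear_scale[OF T] endo.linear_scale[OF A(1)] scale_right_diff_distrib)
    have "(N ^^ j) v = \<phi> l ^ j *s (shift l ^^ j) v" for j
    proof (induction j)
      case (Suc j)
      have "N (\<phi> l ^ j *s (shift l ^^ j) v) = \<phi> l *s shift l (\<phi> l ^ j *s (shift l ^^ j) v)"
        by (intro N subspace_scale subspace_gen_eigenspace funpow_shift_in_gen_eigenspace v)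
      then show ?case
        using Suc by (simp add: endo.linear_scale[OF linear_shift] mult.commute)
    qed simp
    then show "\<exists>n. (N ^^ n) v = 0"
      using k by auto
  qed
  then have trN: "endo_trace N = 0"
    using endo_trace_nilpotent[OF linN] by blast
  have AD: "Vector_Spaces.linear scale scale (A \<circ> D)"
    by (rule Vector_Spaces.linear_compose[OF D(1) A(1)])
  have "representation C (A (D c)) c = ev c * \<phi> (ev c)" if "c \<in> C" for c
    using D(2)[OF C(3)[OF that]] A(2)[OF C(3)[OF that]] that C(1)
    by (simp add: endo.linear_scale[OF A(1)] representation_scale span_base representation_basis mult.commute)
  then have trAD: "endo_trace (A \<circ> D) = (\<Sum>c\<in>C. ev c * \<phi> (ev c))"
    by (simp add: endo_trace_eq_sum_representation[OF C(1,2) AD])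
  have "T \<circ> D = (\<lambda>v. (A \<circ> D) v + N v)"
    by (simp add: N_def fun_eq_iff)
  then show ?thesis
    by (simp only: endo_trace_add trN trAD add_0_right)
qed

text \<open>
  Applying a \<open>\<rat>\<close>-linear functional \<open>f\<close> to the relation \<open>\<Sum>c. ev c * f (ev c) = 0\<close> gives
  \<open>\<Sum>c. (f (ev c))\<^sup>2 = 0\<close> over the rationals.
\<close>

lemma nilpotent_if_endo_trace_zero:
  assumes "\<And>\<phi> D. (\<And>l m. \<phi> (l + m) = \<phi> l + \<phi> m) \<Longrightarrow> Vector_Spaces.linear scale scale D \<Longrightarrow>
     (\<And>l v. v \<in> gen_eigenspace l \<Longrightarrow> D v = \<phi> l *s v) \<Longrightarrow> endo_trace (T \<circ> D) = 0"
  shows "\<exists>n. \<forall>v. (T ^^ n) v = 0"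
proof -
  interpret Q: vector_space "\<lambda>(r::rat) (x::'k). of_rat r * x"
    by unfold_locales (auto simp: algebra_simps of_rat_add of_rat_mult)
  interpret QQ: vector_space_pair "\<lambda>(r::rat) (x::'k). of_rat r * x" "(*) :: rat \<Rightarrow> rat \<Rightarrow> rat"
    by unfold_locales (auto simp: algebra_simps)
  have eig0: "v = 0" if v: "v \<in> gen_eigenspace l" and "l \<noteq> 0" for v l
  proof -
    \<comment> \<open>A nonzero \<open>l\<close> is part of a rational basis of the field, so some
      rational functional takes the value 1 at \<open>l\<close>.\<close>
    have "Q.independent {l}"
      using \<open>l \<noteq> 0\<close> by simp
    then obtain f where f: "Vector_Spaces.linear (\<lambda>(r::rat) (x::'k). of_rat r * x) (*) f" "f l = 1"
      using QQ.linear_independent_extend[of "{l}" "\<lambda>_. 1"] by auto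
    obtain D where D: "Vector_Spaces.linear scale scale D"
      "\<And>l v. v \<in> gen_eigenspace l \<Longrightarrow> D v = of_rat (f l) *s v"
      using ex_grading_operator[of "\<lambda>l. of_rat (f l)"] by blast
    obtain C ev where C: "independent C" "span C = UNIV" "\<And>c. c \<in> C \<Longrightarrow> c \<in> gen_eigenspace (ev c)"
      by (rule ex_adapted_basis) blast
    have finC: "finite C"
      using C(1) by (rule finiteI_independent)
    have "endo_trace (T \<circ> D) = 0"
      using assms[of "\<lambda>l. of_rat (f l)" D] D by (simp add: QQ.linear_add[OF f(1)] of_rat_add)
    then have "(\<Sum>c\<in>C. of_rat (f (ev c)) * ev c) = 0"
      using endo_trace_comp_grading_operator[OF C D] by (simp add: mult.commute)
    then have "f (\<Sum>c\<in>C. of_rat (f (ev c)) * ev c) = 0"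
      using QQ.linear_0[OF f(1)] by simp
    then have "(\<Sum>c\<in>C. f (ev c) * f (ev c)) = 0"
      by (simp add: QQ.linear_sum[OF f(1)] QQ.linear_scale[OF f(1)])
    \<comment> \<open>Squares of rationals are nonnegative, so every term vanishes. Then
      \<open>D\<close> is 0 on \<open>C\<close> and hence everywhere, while it fixes
      \<open>v\<close> because \<open>f l = 1\<close>.\<close>
    then have "\<forall>c\<in>C. f (ev c) * f (ev c) = 0"
      using finC by (subst (asm) sum_nonneg_eq_0_iff) auto
    then have "D c = 0" if "c \<in> C" for c
      using D(2)[OF C(3)[OF that]] that by simp
    then have "D v = 0"
      using endo.linear_eq_0_on_span[OF D(1), of C v] C(2) by blast
    then show "v = 0"
      using D(2)[OF v] f(2) by simp
  qed
  \<comment> \<open>Only the eigenvalue 0 is left, and there the shift is \<open>T\<close>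
    itself.\<close>
  have "\<exists>n. (T ^^ n) v = 0" if "v \<in> (\<Union>l. gen_eigenspace l)" for v
  proof -
    have "shift 0 = T" by (simp add: shift_def fun_eq_iff)
    moreover have "v \<in> gen_eigenspace 0"
      using that eig0 subspace_0[OF subspace_gen_eigenspace] by blast
    ultimately show ?thesis
      unfolding gen_eigenspace_def by simp
  qed
  then show ?thesis
    by (rule locally_nilpotent_imp_nilpotent[OF T span_gen_eigenspaces])
qed

end

subsection \<open>Engel's theorem and the Killing form\<close>

lemma (in lie_algebra) br_anticommute:
  assumes "x \<in> L" "y \<in> L"
  shows "br x y = - br y x"
proof -
  have "x + y \<in> L"
    using assms subspace_carrier by (simp add: subspace_add)
  then have "br (x + y) (x + y) = (br x x + br y x) + (br x y + br y y)"
    using assms by (simp only: br_add_left br_add_right)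
  then have "br x y + br y x = 0"
    using assms \<open>x + y \<in> L\<close> by (simp add: br_self add.commute)
  then show ?thesis
    by (simp add: eq_neg_iff_add_eq_0)
qed

locale fd_lie_algebra = finite_dimensional_vector_space scale Basis + lie_algebra scale UNIV br
  for scale :: "'k::field \<Rightarrow> 'v::ab_group_add \<Rightarrow> 'v" (infixr \<open>*s\<close> 75)
    and Basis :: "'v set" and br :: "'v \<Rightarrow> 'v \<Rightarrow> 'v"
begin

interpretation endo: vector_space_pair scale scale
  by unfold_locales

lemma linear_ad: "Vector_Spaces.linear scale scale (br x)"
  by unfold_locales (simp_all add: br_add_right br_scale_right)

lemma linear_br_left: "Vector_Spaces.linear scale scale (\<lambda>x. br x y)"
  by unfold_locales (simp_all add: br_add_left br_scale_left)

lemma br_skew: "br x y = - br y x"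
  by (rule br_anticommute) auto

text \<open>The Jacobi identity as \<open>ad [x, y] = [ad x, ad y]\<close>, the form suited to
  traces.\<close>

lemma br_br_left: "br (br x y) z = br x (br y z) - br y (br x z)"
proof -
  have "br x (br y z) + br y (br z x) + br z (br x y) = 0"
    by (rule jacobi) auto
  moreover have "br z (br x y) = - br (br x y) z"
    by (rule br_skew)
  moreover have "br y (br z x) = - br y (br x z)"
    by (subst br_skew[of z x]) (rule endo.linear_neg[OF linear_ad])
  ultimately show ?thesis
    by (simp add: algebra_simps add_eq_0_iff)
qed

text \<open>One operation covers several series: iterating \<open>bracket_span UNIV\<close> on
  \<open>UNIV\<close> gives the lower central series, \<open>bracket_span I I\<close> is the derived
  algebra of \<open>I\<close>, and a smaller \<open>N\<close> acting on the whole space gives the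
  series used for Engel's theorem.\<close>

definition bracket_span :: "'v set \<Rightarrow> 'v set \<Rightarrow> 'v set" where
  "bracket_span N W = span {br n w | n w. n \<in> N \<and> w \<in> W}"

lemma br_in_bracket_span: "n \<in> N \<Longrightarrow> w \<in> W \<Longrightarrow> br n w \<in> bracket_span N W"
  unfolding bracket_span_def by (blast intro: span_base)

lemma bracket_span_subset:
  assumes "subspace U" "\<And>n w. n \<in> N \<Longrightarrow> w \<in> W \<Longrightarrow> br n w \<in> U"
  shows "bracket_span N W \<subseteq> U"
  unfolding bracket_span_def using assms by (intro span_minimal) auto

lemma subspace_bracket_span: "subspace (bracket_span N W)"
  unfolding bracket_span_def by (rule subspace_span)

lemma bracket_span_mono: "W \<subseteq> W' \<Longrightarrow> bracket_span N W \<subseteq> bracket_span N W'"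
  by (intro bracket_span_subset subspace_bracket_span br_in_bracket_span) auto

text \<open>
  Jacobson's argument: if \<open>[N, a] \<subseteq> N\<close>, then \<open>ad a\<close> preserves the terms of the series
  of \<open>N\<close>, and long enough words in \<open>span (insert a N)\<close> lead from each term to the next.
\<close>

lemma engel_extend:
  assumes N: "subspace N" "(bracket_span N ^^ k) UNIV = {0}"
    and a: "\<And>n. n \<in> N \<Longrightarrow> br n a \<in> N" and nil: "\<And>v. (br a ^^ m) v = 0"
  shows "\<exists>k. (bracket_span (span (insert a N)) ^^ k) UNIV = {0}"
proof -
  define V where "V j = (bracket_span N ^^ j) UNIV" for j
  define N' where "N' = span (insert a N)"
  have subV: "subspace (V j)" for j
    by (cases j) (simp_all add: V_def subspace_bracket_span)
  have V_dec: "V (Suc j) \<subseteq> V j" for j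
  proof (induction j)
    case (Suc j)
    then show ?case
      using bracket_span_mono[OF Suc] by (simp add: V_def)
  qed (simp add: V_def)
  have N_V: "br n v \<in> V (Suc j)" if "n \<in> N" "v \<in> V j" for n v j
    using that by (simp add: V_def br_in_bracket_span)
  have a_V: "br a v \<in> V j" if "v \<in> V j" for v j
    using that
  proof (induction j arbitrary: v)
    case (Suc j)
    have "V (Suc j) \<subseteq> {v. br a v \<in> V (Suc j)}"
      unfolding V_def funpow.simps(2) comp_def
    proof (rule bracket_span_subset)
      show "subspace {v. br a v \<in> bracket_span N ((bracket_span N ^^ j) UNIV)}"
        by (rule endo.linear_subspace_linear_preimage[OF linear_ad subspace_bracket_span])
      fix n w assume n: "n \<in> N" "w \<in> (bracket_span N ^^ j) UNIV"
      have "br a (br n w) = br n (br a w) - br (br n a) w"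
        by (simp add: br_br_left)
      moreover have "br n (br a w) \<in> V (Suc j)" "br (br n a) w \<in> V (Suc j)"
        using n Suc.IH[of w] N_V[OF n(1), of "br a w" j] N_V[OF a[OF n(1)], of w j] by (simp_all add: V_def)
      ultimately show "br n w \<in> {v. br a v \<in> bracket_span N ((bracket_span N ^^ j) UNIV)}"
        using subspace_diff[OF subV, of _ "Suc j"] by (simp add: V_def)
    qed
    then show ?case using Suc.prems by blast
  qed (simp add: V_def)
  have a_pow_V: "(br a ^^ i) v \<in> V j" if "v \<in> V j" for i v j
    by (induction i) (auto intro: a_V that)
  \<comment> \<open>Modulo \<open>V (Suc j)\<close>, an element of \<open>N'\<close> acts on
    \<open>V j\<close> as a multiple of \<open>br a\<close>.\<close>
  have N'_step: "br n' v \<in> span (br a ` {v} \<union> V (Suc j))" if "n' \<in> N'" "v \<in> V j" for n' v j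
  proof -
    obtain c where c: "n' - c *s a \<in> N"
      using \<open>n' \<in> N'\<close> span_breakdown_eq[of n' a N] N(1)[folded span_eq_iff] unfolding N'_def by auto
    have "br n' v = br (n' - c *s a) v + c *s br a v"
      by (simp add: endo.linear_diff[OF linear_br_left] endo.linear_scale[OF linear_br_left])
    moreover have "br (n' - c *s a) v \<in> V (Suc j)"
      by (rule N_V[OF c that(2)])
    ultimately show ?thesis
      by (auto intro!: span_add span_scale intro: span_base)
  qed
  have N'_V: "br n' v \<in> V j" if "n' \<in> N'" "v \<in> V j" for n' v j
  proof -
    have "span (br a ` {v} \<union> V (Suc j)) \<subseteq> V j"
      using a_V[OF that(2)] V_dec subV by (intro span_minimal) auto
    then show ?thesis using N'_step[OF that] by blast
  qed
  \<comment> \<open>Hence a word of length \<open>i\<close> acts on \<open>V j\<close>, modulo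
    \<open>V (Suc j)\<close>, as a multiple of \<open>br a ^^ i\<close>, which is 0 for
    \<open>i = m\<close>.\<close>
  have words: "(bracket_span N' ^^ i) (V j) \<subseteq> span ((br a ^^ i) ` V j \<union> V (Suc j))" for i j
  proof (induction i)
    case 0
    show ?case by (auto intro: span_base)
  next
    case (Suc i)
    let ?U = "span ((br a ^^ Suc i) ` V j \<union> V (Suc j))"
    have "br n u \<in> ?U" if "n \<in> N'" "u \<in> (bracket_span N' ^^ i) (V j)" for n u
    proof -
      have "span ((br a ^^ i) ` V j \<union> V (Suc j)) \<subseteq> {u. br n u \<in> ?U}"
      proof (rule span_minimal)
        show "subspace {u. br n u \<in> ?U}"
          by (rule endo.linear_subspace_linear_preimage[OF linear_ad subspace_span])
        have "br n ((br a ^^ i) v) \<in> ?U" if v: "v \<in> V j" for v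
        proof -
          have "span (br a ` {(br a ^^ i) v} \<union> V (Suc j)) \<subseteq> ?U"
            using v by (intro span_mono) auto
          then show ?thesis
            using N'_step[OF \<open>n \<in> N'\<close> a_pow_V[OF v]] by blast
        qed
        moreover have "br n v \<in> ?U" if "v \<in> V (Suc j)" for v
          using N'_V[OF \<open>n \<in> N'\<close> that] by (intro span_base) simp
        ultimately show "(br a ^^ i) ` V j \<union> V (Suc j) \<subseteq> {u. br n u \<in> ?U}"
          by auto
      qed
      then show ?thesis using Suc that(2) by blast
    qed
    then show ?case
      by (simp only: funpow.simps comp_def) (intro bracket_span_subset subspace_span)
  qed
  have "(br a ^^ m) ` V j \<union> V (Suc j) \<subseteq> V (Suc j)" for j
    using nil subspace_0[OF subV] by auto
  then have step: "(bracket_span N' ^^ m) (V j) \<subseteq> V (Suc j)" for j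
    using words[of m j] span_minimal[OF _ subV, of _ "Suc j"] by blast
  have pow_mono: "(bracket_span N' ^^ i) W \<subseteq> (bracket_span N' ^^ i) W'" if "W \<subseteq> W'" for i W W'
    by (induction i) (use that in \<open>auto dest: bracket_span_mono\<close>)
  \<comment> \<open>Each step down the series of \<open>N\<close> costs \<open>m\<close> brackets
    with \<open>N'\<close>.\<close>
  have "(bracket_span N' ^^ (m * j)) UNIV \<subseteq> V j" for j
  proof (induction j)
    case (Suc j)
    have "(bracket_span N' ^^ (m * Suc j)) UNIV = (bracket_span N' ^^ m) ((bracket_span N' ^^ (m * j)) UNIV)"
      by (simp add: funpow_add)
    then show ?case
      using pow_mono[OF Suc, of m] step[of j] by simp
  qed (simp add: V_def)
  then have "(bracket_span N' ^^ (m * k)) UNIV \<subseteq> {0}"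
    using N(2) unfolding V_def by metis
  moreover have "subspace ((bracket_span N' ^^ i) UNIV)" for i
    by (cases i) (simp_all add: subspace_bracket_span)
  ultimately have "(bracket_span N' ^^ (m * k)) UNIV = {0}"
    using subspace_0 by blast
  then show ?thesis unfolding N'_def by blast
qed

text \<open>Among the subspaces whose iterated brackets on the whole space reach 0, take
  \<open>N\<close> of greatest dimension. If \<open>N\<close> were proper, its own series would
  supply an \<open>a\<close> outside \<open>N\<close> with \<open>[N, a]\<close> inside
  \<open>N\<close>, and \<open>engel_extend\<close> would enlarge \<open>N\<close>.\<close>

theorem engel:
  assumes nil: "\<And>x. \<exists>m. \<forall>v. (br x ^^ m) v = 0"
  shows "\<exists>k. (bracket_span UNIV ^^ k) UNIV = {0}"
proof -
  define good where "good N \<longleftrightarrow> subspace N \<and> (\<exists>k. (bracket_span N ^^ k) UNIV = {0})" for N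
  have "bracket_span {0} UNIV = {0}"
  proof
    show "bracket_span {0} UNIV \<subseteq> {0}"
      by (rule bracket_span_subset) (auto simp: endo.linear_0[OF linear_br_left])
  qed (use subspace_0[OF subspace_bracket_span] in auto)
  then have "(bracket_span {0} ^^ 1) UNIV = {0}"
    by simp
  then have "good {0}"
    unfolding good_def using subspace_single_0 by blast
  then obtain N where N: "good N" and max: "\<And>N'. good N' \<Longrightarrow> dim N' \<le> dim N"
    using ex_has_greatest_nat[of good "{0}" dim "Suc dimension"] dim_subset_UNIV by (auto simp: less_Suc_eq_le)
  then obtain k where subN: "subspace N" and k: "(bracket_span N ^^ k) UNIV = {0}"
    unfolding good_def by blast
  have "N = UNIV"
  proof (rule ccontr)
    assume "N \<noteq> UNIV"
    let ?P = "\<lambda>j. (bracket_span N ^^ j) UNIV \<subseteq> N"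
    have "?P k" using k subspace_0[OF subN] by simp
    \<comment> \<open>The first index at which the series of \<open>N\<close> falls into
      \<open>N\<close> is positive, since the series starts at \<open>UNIV\<close>. The preceding
      term contains an \<open>a\<close> outside \<open>N\<close>, and brackets of \<open>N\<close>
      with \<open>a\<close> lie in term \<open>j\<close>, hence in \<open>N\<close>.\<close>
    define j where "j = (LEAST j. ?P j)"
    have j: "?P j"
      unfolding j_def using \<open>?P k\<close> by (rule LeastI)
    have j_min: "\<not> ?P i" if "i < j" for i
      using that unfolding j_def by (rule not_less_Least)
    have "j \<noteq> 0" using j \<open>N \<noteq> UNIV\<close> by (cases j) auto
    then obtain i where i: "j = Suc i" by (cases j) auto
    then obtain a where a: "a \<in> (bracket_span N ^^ i) UNIV" "a \<notin> N"
      using j_min[of i] by auto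
    have "br n a \<in> N" if "n \<in> N" for n
      using br_in_bracket_span[OF that a(1)] j by (auto simp: i)
    moreover obtain m where "\<And>v. (br a ^^ m) v = 0"
      using nil by blast
    ultimately have "good (span (insert a N))"
      unfolding good_def using engel_extend[OF subN k] by blast
    then have "dim (span (insert a N)) \<le> dim N"
      by (rule max)
    then have "N = span (insert a N)"
      by (intro subspace_dim_equal subN subspace_span) (auto intro: span_base)
    then show False
      using a(2) span_base[of a "insert a N"] by blast
  qed
  then show ?thesis using k by blast
qed

text \<open>By linearity let \<open>x = [a, b]\<close>. Cyclicity turns the trace into that of
  \<open>ad a\<close> composed with the commutator of \<open>ad b\<close> and \<open>D\<close>; this
  commutator is \<open>- ad (D b)\<close>, so the result is
  \<open>- killing_form br a (D b)\<close>.\<close>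

lemma endo_trace_ad_comp_derivation:
  assumes D: "Vector_Spaces.linear scale scale D" "\<And>x y. D (br x y) = br (D x) y + br x (D y)"
    and K: "\<And>x y. killing_form br x y = 0"
    and x: "x \<in> bracket_span UNIV UNIV"
  shows "endo_trace (br x \<circ> D) = 0"
proof -
  have "bracket_span UNIV UNIV \<subseteq> {x. endo_trace (br x \<circ> D) = 0}"
  proof (rule bracket_span_subset)
    show "subspace {x. endo_trace (br x \<circ> D) = 0}"
    proof (rule subspaceI)
      show "0 \<in> {x. endo_trace (br x \<circ> D) = 0}"
        using endo_trace_scale[of 0 id] by (simp add: comp_def endo.linear_0[OF linear_br_left])
    next
      fix x y assume "x \<in> {x. endo_trace (br x \<circ> D) = 0}" "y \<in> {x. endo_trace (br x \<circ> D) = 0}"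
      then show "x + y \<in> {x. endo_trace (br x \<circ> D) = 0}"
        by (simp add: comp_def br_add_left endo_trace_add)
    next
      fix c x assume "x \<in> {x. endo_trace (br x \<circ> D) = 0}"
      then show "c *s x \<in> {x. endo_trace (br x \<circ> D) = 0}"
        by (simp add: comp_def br_scale_left endo_trace_scale)
    qed
    fix a b :: 'v
    have aD: "Vector_Spaces.linear scale scale (br a \<circ> D)"
      by (rule Vector_Spaces.linear_compose[OF D(1) linear_ad])
    have "br (br a b) \<circ> D = (\<lambda>v. (br a \<circ> br b \<circ> D) v - (br b \<circ> (br a \<circ> D)) v)"
      by (simp add: fun_eq_iff br_br_left)
    then have "endo_trace (br (br a b) \<circ> D) = endo_trace (br a \<circ> br b \<circ> D) - endo_trace ((br a \<circ> D) \<circ> br b)"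
      by (simp only: endo_trace_diff endo_trace_comp_commute[OF linear_ad aD])
    also have "\<dots> = endo_trace (\<lambda>v. (br a \<circ> br b \<circ> D) v - ((br a \<circ> D) \<circ> br b) v)"
      by (simp only: endo_trace_diff)
    also have "(\<lambda>v. (br a \<circ> br b \<circ> D) v - ((br a \<circ> D) \<circ> br b) v) = (\<lambda>v. (-1) *s (br a \<circ> br (D b)) v)"
      by (simp add: fun_eq_iff D(2) endo.linear_add[OF linear_ad])
    also have "endo_trace \<dots> = - killing_form br a (D b)"
      by (simp only: endo_trace_scale killing_form_def comp_def) simp
    finally show "br a b \<in> {x. endo_trace (br x \<circ> D) = 0}"
      using K by (simp add: comp_def)
  qed
  then show ?thesis using x by blast
qed

end

section \<open>Derivations from the eigenvalue grading, and a weak Cartan criterion\<close>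

locale alg_closed_lie_algebra = fd_lie_algebra scale Basis br
  for scale :: "'k::{alg_closed_field, field_char_0} \<Rightarrow> 'v::ab_group_add \<Rightarrow> 'v" (infixr \<open>*s\<close> 75)
    and Basis :: "'v set" and br :: "'v \<Rightarrow> 'v \<Rightarrow> 'v"
begin

interpretation endo: vector_space_pair scale scale
  by unfold_locales

sublocale ad: alg_closed_endomorphism scale Basis "br x" for x
  by unfold_locales (simp_all add: br_add_right br_scale_right)

text \<open>\<open>shift_br\<close> is a Leibniz rule, so each application of the shift by
  \<open>l + m\<close> lowers the exponent of one of the two factors. If \<open>i\<close> and
  \<open>j\<close> kill the factors, \<open>i + j\<close> kills the bracket.\<close>

lemma br_gen_eigenspaces:
  assumes "v \<in> ad.gen_eigenspace x l" "w \<in> ad.gen_eigenspace x m"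
  shows "br v w \<in> ad.gen_eigenspace x (l + m)"
proof -
  have shift_br: "ad.shift x (l + m) (br v w) = br (ad.shift x l v) w + br v (ad.shift x m w)" for v w
    using br_br_left[of x v w]
    by (simp add: ad.shift_def endo.linear_diff[OF linear_br_left] endo.linear_diff[OF linear_ad]
        endo.linear_scale[OF linear_br_left] endo.linear_scale[OF linear_ad] algebra_simps)
  have "(ad.shift x l ^^ i) v = 0 \<Longrightarrow> (ad.shift x m ^^ j) w = 0 \<Longrightarrow>
      (ad.shift x (l + m) ^^ (i + j)) (br v w) = 0" for i j
  proof (induction "i + j" arbitrary: i j v w)
    case 0
    then show ?case by (simp add: endo.linear_0[OF linear_br_left])
  next
    case (Suc n)
    note lin = linear_funpow[OF ad.linear_shift[of x "l + m"]]
    have 1: "(ad.shift x (l + m) ^^ n) (br (ad.shift x l v) w) = 0"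
    proof (cases i)
      case 0
      then show ?thesis
        using Suc.prems by (simp add: endo.linear_0[OF linear_br_left] endo.linear_0[OF lin] endo.linear_0[OF ad.linear_shift])
    next
      case (Suc i')
      then show ?thesis
        using Suc.hyps(1)[of i' j "ad.shift x l v" w] \<open>Suc n = i + j\<close> Suc.prems by (simp add: funpow_swap1)
    qed
    have 2: "(ad.shift x (l + m) ^^ n) (br v (ad.shift x m w)) = 0"
    proof (cases j)
      case 0
      then show ?thesis
        using Suc.prems by (simp add: endo.linear_0[OF linear_ad] endo.linear_0[OF lin] endo.linear_0[OF ad.linear_shift])
    next
      case (Suc j')
      then show ?thesis
        using Suc.hyps(1)[of i j' v "ad.shift x m w"] \<open>Suc n = i + j\<close> Suc.prems by (simp add: funpow_swap1)
    qed
    have "(ad.shift x (l + m) ^^ Suc n) (br v w) = 0"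
      by (simp only: funpow_Suc_right comp_apply shift_br endo.linear_add[OF lin] 1 2) simp
    then show ?case by (simp only: \<open>Suc n = i + j\<close>)
  qed
  then show ?thesis
    using assms unfolding ad.gen_eigenspace_def by blast
qed

text \<open>The defect \<open>E\<close> of the Leibniz rule is bilinear. It vanishes on pairs of
  generalized eigenvectors because eigenvalues add under the bracket and \<open>\<phi>\<close> is
  additive, and such vectors span.\<close>

lemma grading_operator_derivation:
  assumes "\<And>l m. \<phi> (l + m) = \<phi> l + \<phi> m"
    and D: "Vector_Spaces.linear scale scale D" "\<And>l v. v \<in> ad.gen_eigenspace x l \<Longrightarrow> D v = \<phi> l *s v"
  shows "D (br v w) = br (D v) w + br v (D w)"
proof -
  let ?U = "\<Union>l. ad.gen_eigenspace x l"
  note lin1 = Vector_Spaces.linear_compose[unfolded comp_def]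
  define E where "E v w = D (br v w) - (br (D v) w + br v (D w))" for v w
  have E_right: "Vector_Spaces.linear scale scale (\<lambda>w. E v w)" for v
    unfolding E_def
    by (intro endo.linear_compose_sub endo.linear_compose_add lin1[OF linear_ad D(1)] lin1[OF D(1) linear_ad] linear_ad)
  have E_left: "Vector_Spaces.linear scale scale (\<lambda>v. E v w)" for w
    unfolding E_def
    by (intro endo.linear_compose_sub endo.linear_compose_add lin1[OF linear_br_left D(1)]
        lin1[OF D(1) linear_br_left] linear_br_left)
  have E_homogeneous: "E v w = 0" if v: "v \<in> ?U" and w: "w \<in> ?U" for v w
  proof -
    obtain l m where lm: "v \<in> ad.gen_eigenspace x l" "w \<in> ad.gen_eigenspace x m"
      using v w by blast
    show ?thesis
      using D(2)[OF lm(1)] D(2)[OF lm(2)] D(2)[OF br_gen_eigenspaces[OF lm]] assms(1)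
      by (simp add: E_def endo.linear_scale[OF linear_br_left] endo.linear_scale[OF linear_ad] algebra_simps)
  qed
  have "E v w = 0" if "v \<in> ?U" for v
    using endo.linear_eq_0_on_span[OF E_right[of v], of ?U w] E_homogeneous[OF that]
    unfolding ad.span_gen_eigenspaces by simp
  then have "E v w = 0"
    using endo.linear_eq_0_on_span[OF E_left[of w], of ?U v]
    unfolding ad.span_gen_eigenspaces by simp
  then show ?thesis by (simp add: E_def)
qed

theorem perfect_killing_form_nonzero:
  assumes perfect: "bracket_span UNIV UNIV = UNIV" and nontrivial: "(UNIV :: 'v set) \<noteq> {0}"
  shows "\<exists>x y. killing_form br x y \<noteq> 0"
proof (rule ccontr)
  assume "\<not> ?thesis"
  then have K: "killing_form br x y = 0" for x y by blast
  have "\<exists>n. \<forall>v. (br x ^^ n) v = 0" for x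
  proof (rule ad.nilpotent_if_endo_trace_zero)
    fix \<phi> D
    assume \<phi>: "\<And>l m :: 'k. \<phi> (l + m) = \<phi> l + \<phi> m" and D: "Vector_Spaces.linear scale scale D"
      "\<And>l v. v \<in> ad.gen_eigenspace x l \<Longrightarrow> D v = \<phi> l *s v"
    have "D (br v w) = br (D v) w + br v (D w)" for v w
      using \<phi> D by (rule grading_operator_derivation)
    moreover have "x \<in> bracket_span UNIV UNIV"
      by (simp add: perfect)
    ultimately show "endo_trace (br x \<circ> D) = 0"
      using endo_trace_ad_comp_derivation[OF D(1)] K by blast
  qed
  then obtain k where "(bracket_span UNIV ^^ k) UNIV = {0}"
    using engel by blast
  \<comment> \<open>A perfect algebra has a constant lower central series, so reaching 0 would make
    it trivial.\<close>
  moreover have "(bracket_span UNIV ^^ k) UNIV = UNIV"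
    by (induction k) (simp_all add: perfect)
  ultimately show False using nontrivial by simp
qed

end

section \<open>Ideals, and invariance of the Killing form\<close>

context fd_lie_algebra
begin

interpretation endo: vector_space_pair scale scale
  by unfold_locales

lemma ideal_UNIV_iff: "ideal I \<longleftrightarrow> subspace I \<and> (\<forall>x\<in>I. \<forall>y. br x y \<in> I)"
  by (auto simp: ideal_def)

lemma ideal_br_right: "ideal I \<Longrightarrow> x \<in> I \<Longrightarrow> br y x \<in> I"
  by (subst br_skew) (simp add: ideal_UNIV_iff subspace_neg)

lemma ideal_Int: "ideal I \<Longrightarrow> ideal J \<Longrightarrow> ideal (I \<inter> J)"
  by (simp add: ideal_UNIV_iff subspace_inter)

lemma ideal_bracket_span:
  assumes "ideal I" "ideal J"
  shows "ideal (bracket_span I J)"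
  unfolding ideal_UNIV_iff
proof (intro conjI ballI allI)
  fix x y assume x: "x \<in> bracket_span I J"
  have "bracket_span I J \<subseteq> {x. br x y \<in> bracket_span I J}"
  proof (rule bracket_span_subset)
    show "subspace {x. br x y \<in> bracket_span I J}"
      by (rule endo.linear_subspace_linear_preimage[OF linear_br_left subspace_bracket_span])
    fix i j assume ij: "i \<in> I" "j \<in> J"
    have "br (br i j) y = br i (br j y) + br (br i y) j"
      using br_br_left[of i j y] br_skew[of "br i y" j] by simp
    moreover have "br j y \<in> J" "br i y \<in> I"
      using assms ij by (simp_all add: ideal_UNIV_iff)
    ultimately show "br i j \<in> {x. br x y \<in> bracket_span I J}"
      using ij by (simp add: subspace_add subspace_bracket_span br_in_bracket_span)
  qed
  then show "br x y \<in> bracket_span I J" using x by blast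
qed (rule subspace_bracket_span)

lemma derived_eq_bracket_span: "derived I = bracket_span I I"
  by (simp add: derived_def bracket_span_def)

text \<open>A nonzero intersection is all of \<open>M\<close> by minimality, so \<open>M\<close>
  lies in \<open>I\<close>; being perfect, \<open>M\<close> then survives in every derived term of
  \<open>I\<close>.\<close>

lemma solvable_ideal_Int_minimal_perfect:
  assumes I: "ideal I" "solvable I"
    and M: "ideal M" "bracket_span M M = M" "M \<noteq> {0}"
    and minimal: "\<And>J. ideal J \<Longrightarrow> J \<subseteq> M \<Longrightarrow> J = {0} \<or> J = M"
  shows "I \<inter> M = {0}"
proof (rule ccontr)
  assume "I \<inter> M \<noteq> {0}"
  then have "M \<subseteq> I"
    using minimal[OF ideal_Int[OF I(1) M(1)]] by blast
  have "M \<subseteq> (derived ^^ n) I" for n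
  proof (induction n)
    case (Suc n)
    have "bracket_span M M \<subseteq> bracket_span ((derived ^^ n) I) ((derived ^^ n) I)"
      using Suc by (intro bracket_span_subset subspace_bracket_span br_in_bracket_span) auto
    then show ?case
      by (simp add: M(2) derived_eq_bracket_span[of "(derived ^^ n) I"])
  qed (simp add: \<open>M \<subseteq> I\<close>)
  then have "M \<subseteq> {0}"
    using I(2) unfolding solvable_def by metis
  then show False
    using M(1,3) subspace_0[of M] by (auto simp: ideal_UNIV_iff)
qed

lemma killing_form_commute: "killing_form br x y = killing_form br y x"
  unfolding killing_form_def by (rule endo_trace_comp_commute[OF linear_ad linear_ad])

lemma linear_killing_form_left: "Vector_Spaces.linear scale (*) (\<lambda>x. killing_form br x y)"
  by (unfold_locales)
    (simp_all add: killing_form_def comp_def br_add_left br_scale_left endo_trace_add endo_trace_scale algebra_simps)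

lemma linear_killing_form_right: "Vector_Spaces.linear scale (*) (\<lambda>y. killing_form br x y)"
  using linear_killing_form_left by (subst killing_form_commute)

text \<open>Cyclicity replaces \<open>tr (ad y ad x ad z)\<close> by
  \<open>tr (ad x ad z ad y)\<close>, leaving \<open>ad x\<close> composed with the commutator of
  \<open>ad y\<close> and \<open>ad z\<close>.\<close>

lemma killing_form_invariant: "killing_form br (br x y) z = killing_form br x (br y z)"
proof -
  have yz: "Vector_Spaces.linear scale scale (br x \<circ> br z)"
    by (rule Vector_Spaces.linear_compose[OF linear_ad linear_ad])
  have "br (br x y) \<circ> br z = (\<lambda>v. (br x \<circ> br y \<circ> br z) v - (br y \<circ> (br x \<circ> br z)) v)"
    by (simp add: fun_eq_iff br_br_left)
  then have "killing_form br (br x y) z = endo_trace (br x \<circ> br y \<circ> br z) - endo_trace ((br x \<circ> br z) \<circ> br y)"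
    by (simp only: killing_form_def endo_trace_diff endo_trace_comp_commute[OF linear_ad yz])
  also have "\<dots> = endo_trace (\<lambda>v. (br x \<circ> br y \<circ> br z) v - ((br x \<circ> br z) \<circ> br y) v)"
    by (simp only: endo_trace_diff)
  also have "(\<lambda>v. (br x \<circ> br y \<circ> br z) v - ((br x \<circ> br z) \<circ> br y) v) = br x \<circ> br (br y z)"
    by (simp add: fun_eq_iff br_br_left endo.linear_diff[OF linear_ad])
  finally show ?thesis
    by (simp only: killing_form_def)
qed

lemma ideal_killing_radical: "ideal {x. \<forall>y. killing_form br x y = 0}"
proof -
  interpret form: vector_space_pair scale "(*)"
    by unfold_locales (simp_all add: algebra_simps)
  have "subspace {x. \<forall>y. killing_form br x y = 0}"
    by (auto intro!: subspaceI simp: form.linear_0[OF linear_killing_form_left]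
        form.linear_add[OF linear_killing_form_left] form.linear_scale[OF linear_killing_form_left])
  then show ?thesis
    by (simp add: ideal_UNIV_iff killing_form_invariant)
qed

text \<open>\<open>ad (\<theta> x) ad (\<theta> y)\<close> is the conjugate of
  \<open>ad x ad y\<close> by the involution \<open>\<theta>\<close>, and the trace is invariant
  under conjugation.\<close>

lemma killing_form_automorphism:
  assumes \<theta>: "Vector_Spaces.linear scale scale \<theta>" "\<And>x. \<theta> (\<theta> x) = x"
    and hom: "\<And>x y. \<theta> (br x y) = br (\<theta> x) (\<theta> y)"
  shows "killing_form br (\<theta> x) (\<theta> y) = killing_form br x y"
proof -
  let ?f = "br x \<circ> br y \<circ> \<theta>"
  have f: "Vector_Spaces.linear scale scale ?f"
    by (intro Vector_Spaces.linear_compose[OF \<theta>(1)] Vector_Spaces.linear_compose[OF linear_ad] linear_ad)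
  have "br (\<theta> x) \<circ> br (\<theta> y) = \<theta> \<circ> ?f"
    by (simp add: fun_eq_iff hom \<theta>(2))
  moreover have "?f \<circ> \<theta> = br x \<circ> br y"
    by (simp add: fun_eq_iff \<theta>(2))
  ultimately show ?thesis
    using endo_trace_comp_commute[OF \<theta>(1) f] by (simp only: killing_form_def)
qed

end

subsection \<open>Simple involutive Hom-Lie algebras\<close>

locale simple_involutive_hom_lie_algebra =
  finite_dimensional_vector_space scale Basis + simple_hom_lie_algebra scale br \<theta> +
  multiplicative_hom_lie_algebra scale br \<theta> + involutive_hom_lie_algebra scale br \<theta>
  for scale :: "'k::{alg_closed_field, field_char_0} \<Rightarrow> 'v::ab_group_add \<Rightarrow> 'v" (infixr \<open>*s\<close> 75)
    and Basis :: "'v set" and br :: "'v \<Rightarrow> 'v \<Rightarrow> 'v" and \<theta> :: "'v \<Rightarrow> 'v"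
begin

interpretation endo: vector_space_pair scale scale
  by unfold_locales

text \<open>The bracket of the Lie algebra \<open>\<gg>\<^sub>\<theta>\<close>.\<close>

definition tw :: "'v \<Rightarrow> 'v \<Rightarrow> 'v" where
  "tw x y = \<theta> (br x y)"

lemma br_eq_tw: "br x y = \<theta> (tw x y)"
  by (simp add: tw_def involutive)

lemma \<theta>_tw: "\<theta> (tw x y) = tw (\<theta> x) (\<theta> y)"
  by (simp add: tw_def multiplicative)

text \<open>The inner and outer twists cancel, which turns the Hom-Jacobi identity into the Jacobi
  identity of \<open>tw\<close>.\<close>

lemma tw_tw: "tw x (tw y z) = br (\<theta> x) (br y z)"
  by (simp add: tw_def multiplicative involutive)

text \<open>Skew-symmetry makes twice the bracket vanish, and 2 is invertible in characteristic
  0.\<close>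

lemma br_self: "br x x = 0"
proof -
  have "br x x + br x x = 0"
    using br_skew[of x x] by (metis add.right_inverse)
  then have "2 *s br x x = 0"
    using scale_left_distrib[of 1 1 "br x x"] by simp
  then show ?thesis by simp
qed

sublocale tw: alg_closed_lie_algebra scale Basis tw
proof unfold_locales
  show "tw x (tw y z) + tw y (tw z x) + tw z (tw x y) = 0" for x y z
    by (simp add: tw_tw hom_jacobi)
qed (simp_all add: tw_def br_self endo.linear_0[OF linear_twist] endo.linear_add[OF linear_twist]
    endo.linear_scale[OF linear_twist] endo.linear_add[OF linear_br_left] endo.linear_scale[OF linear_br_left]
    endo.linear_add[OF linear_br_right] endo.linear_scale[OF linear_br_right])

text \<open>The bridge through which Hom-simplicity is used: since
  \<open>br x y = \<theta> (tw x y)\<close>, a \<open>\<theta>\<close>-stable ideal for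
  \<open>tw\<close> is an ideal of the Hom-Lie algebra.\<close>

lemma stable_ideal_trivial:
  assumes "tw.ideal I" "\<And>x. x \<in> I \<Longrightarrow> \<theta> x \<in> I"
  shows "I = {0} \<or> I = UNIV"
  by (rule no_proper_ideal) (use assms in \<open>auto simp: ideal_def tw.ideal_UNIV_iff br_eq_tw\<close>)

lemma tw_nonzero: "\<exists>x y. tw x y \<noteq> 0"
  using br_nonzero by (metis br_eq_tw endo.linear_0[OF linear_twist])

lemma ideal_image_twist:
  assumes "tw.ideal I"
  shows "tw.ideal (\<theta> ` I)"
  unfolding tw.ideal_UNIV_iff
proof (intro conjI ballI allI)
  show "subspace (\<theta> ` I)"
    using assms by (intro endo.linear_subspace_image linear_twist) (simp add: tw.ideal_UNIV_iff)
  fix x y assume "x \<in> \<theta> ` I"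
  then obtain i where i: "i \<in> I" "x = \<theta> i" by blast
  then have "tw x y = \<theta> (tw i (\<theta> y))"
    by (simp add: \<theta>_tw involutive)
  then show "tw x y \<in> \<theta> ` I"
    using assms i by (simp add: tw.ideal_UNIV_iff)
qed

lemma image_twist_twist: "\<theta> ` \<theta> ` I = I"
  by (simp add: image_image involutive)

text \<open>The center is a \<open>\<theta>\<close>-stable ideal, and it is proper because the
  bracket is nonzero.\<close>

lemma center_trivial:
  assumes "\<And>y. tw x y = 0"
  shows "x = 0"
proof -
  let ?Z = "{x. \<forall>y. tw x y = 0}"
  have "tw.ideal ?Z"
  proof -
    have "subspace ?Z"
      by (auto intro!: subspaceI simp: endo.linear_0[OF tw.linear_br_left] tw.br_add_left tw.br_scale_left)
    then show ?thesis
      by (simp add: tw.ideal_UNIV_iff endo.linear_0[OF tw.linear_br_left])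
  qed
  moreover have "\<theta> x \<in> ?Z" if "x \<in> ?Z" for x
  proof -
    have "tw (\<theta> x) y = \<theta> (tw x (\<theta> y))" for y
      by (simp add: \<theta>_tw involutive)
    then show ?thesis
      using that by (simp add: endo.linear_0[OF linear_twist])
  qed
  ultimately have "?Z = {0} \<or> ?Z = UNIV"
    by (rule stable_ideal_trivial)
  then show ?thesis
    using assms tw_nonzero by blast
qed

text \<open>The derived algebra is a nonzero \<open>\<theta>\<close>-stable ideal.\<close>

lemma tw_perfect: "tw.bracket_span UNIV UNIV = UNIV"
proof -
  let ?D = "tw.bracket_span UNIV UNIV"
  have "tw.ideal ?D"
    by (intro tw.ideal_bracket_span) (simp_all add: tw.ideal_UNIV_iff)
  moreover have "?D \<subseteq> {x. \<theta> x \<in> ?D}"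
  proof (rule tw.bracket_span_subset)
    show "subspace {x. \<theta> x \<in> ?D}"
      by (rule endo.linear_subspace_linear_preimage[OF linear_twist tw.subspace_bracket_span])
  qed (simp add: \<theta>_tw tw.br_in_bracket_span)
  ultimately have "?D = {0} \<or> ?D = UNIV"
    by (intro stable_ideal_trivial) auto
  moreover obtain x y where "tw x y \<noteq> 0"
    using tw_nonzero by blast
  then have "?D \<noteq> {0}"
    using tw.br_in_bracket_span[of x UNIV y UNIV] by auto
  ultimately show ?thesis by blast
qed

lemma killing_form_nondegenerate:
  assumes "\<And>y. killing_form tw x y = 0"
  shows "x = 0"
proof -
  let ?R = "{x. \<forall>y. killing_form tw x y = 0}"
  have "\<theta> x \<in> ?R" if "x \<in> ?R" for x
  proof -
    have "killing_form tw (\<theta> x) y = killing_form tw x (\<theta> y)" for y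
      using tw.killing_form_automorphism[OF linear_twist involutive \<theta>_tw, of x "\<theta> y"]
      by (simp add: involutive)
    then show ?thesis using that by simp
  qed
  then have "?R = {0} \<or> ?R = UNIV"
    by (intro stable_ideal_trivial tw.ideal_killing_radical)
  moreover obtain x y where "tw x y \<noteq> 0"
    using tw_nonzero by blast
  then have "(UNIV :: 'v set) \<noteq> {0}"
    by blast
  then have "?R \<noteq> UNIV"
    using tw.perfect_killing_form_nonzero[OF tw_perfect] by blast
  ultimately show ?thesis using assms by blast
qed

text \<open>By \<open>tw_tw\<close>, the operators already agree before the trace is taken.\<close>

lemma trace_form_eq_killing_form: "endo_trace (br x \<circ> br y) = killing_form tw (\<theta> x) y"
proof -
  have "br x \<circ> br y = tw (\<theta> x) \<circ> tw y"
    by (simp add: fun_eq_iff tw_tw involutive)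
  then show ?thesis by (simp add: killing_form_def)
qed

text \<open>Since \<open>\<theta>\<close> is an involutive automorphism preserving the Killing form,
  it is self-adjoint for it; moving \<open>\<theta>\<close> across reduces each property to the
  corresponding one of the Killing form.\<close>

lemma quadratic_structure_trace_form:
  "quadratic_structure scale br \<theta> (\<lambda>x y. endo_trace (br x \<circ> br y))"
proof -
  have twist: "killing_form tw (\<theta> x) y = killing_form tw x (\<theta> y)" for x y
    using tw.killing_form_automorphism[OF linear_twist involutive \<theta>_tw, of x "\<theta> y"]
    by (simp add: involutive)
  have "Vector_Spaces.linear scale (*) (\<lambda>x. killing_form tw (\<theta> x) y)" for y
    using Vector_Spaces.linear_compose[OF linear_twist tw.linear_killing_form_left] by (simp add: comp_def)
  moreover have "killing_form tw (\<theta> x) y = killing_form tw (\<theta> y) x" for x y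
    using twist tw.killing_form_commute by metis
  moreover have "x = 0" if "\<forall>y. killing_form tw (\<theta> x) y = 0" for x
  proof -
    have "\<theta> x = 0"
      using that by (intro killing_form_nondegenerate) blast
    then show ?thesis
      using involutive[of x] by (simp add: endo.linear_0[OF linear_twist])
  qed
  moreover have "killing_form tw (\<theta> (br x y)) z = killing_form tw (\<theta> x) (br y z)" for x y z
  proof -
    have "killing_form tw (tw x y) z = killing_form tw x (tw y z)"
      by (rule tw.killing_form_invariant)
    then show ?thesis
      using twist[of x "br y z"] by (simp add: tw_def)
  qed
  moreover have "killing_form tw (\<theta> (\<theta> x)) y = killing_form tw (\<theta> x) (\<theta> y)" for x y
    using twist by simp
  ultimately show ?thesis
    unfolding quadratic_structure_def trace_form_eq_killing_form
    using tw.linear_killing_form_right by blast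
qed

section \<open>Minimal ideals and the decomposition of the twisted algebra\<close>

lemma lie_algebra_subideal:
  assumes "tw.ideal S"
  shows "lie_algebra scale S tw"
proof unfold_locales
  show "tw x (tw y z) + tw y (tw z x) + tw z (tw x y) = 0" for x y z
    by (rule tw.jacobi) auto
qed (use assms in \<open>auto simp: tw.ideal_UNIV_iff tw.br_add_left tw.br_add_right tw.br_scale_left
      tw.br_scale_right tw.br_self\<close>)

text \<open>Take a nonzero ideal of least dimension; a nonzero ideal inside it has the same
  dimension and so equals it.\<close>

lemma ex_minimal_ideal:
  obtains S where "tw.ideal S" "S \<noteq> {0}" "\<And>J. tw.ideal J \<Longrightarrow> J \<subseteq> S \<Longrightarrow> J = {0} \<or> J = S"
proof -
  obtain x y where "tw x y \<noteq> 0"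
    using tw_nonzero by blast
  then have "tw.ideal UNIV \<and> UNIV \<noteq> {0 :: 'v}"
    by (auto simp: tw.ideal_UNIV_iff)
  then obtain S where S: "tw.ideal S" "S \<noteq> {0}" "\<And>J. tw.ideal J \<Longrightarrow> J \<noteq> {0} \<Longrightarrow> dim S \<le> dim J"
    using ex_has_least_nat[of "\<lambda>S. tw.ideal S \<and> S \<noteq> {0}" UNIV dim] by blast
  have "J = {0} \<or> J = S" if "tw.ideal J" "J \<subseteq> S" for J
    using subspace_dim_equal[of J S] S that by (auto simp: tw.ideal_UNIV_iff)
  then show thesis using S(1,2) that by blast
qed

lemma simple_or_direct_sum:
  "simple_lie_algebra scale UNIV tw \<or>
   \<not> simple_lie_algebra scale UNIV tw \<and> semisimple_lie_algebra scale UNIV tw \<and>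
   (\<exists>S. tw.ideal S \<and> simple_lie_algebra scale S tw \<and> tw.direct_sum_of_ideals S (\<theta> ` S))"
proof -
  obtain S where S: "tw.ideal S" "S \<noteq> {0}"
    and minS: "\<And>J. tw.ideal J \<Longrightarrow> J \<subseteq> S \<Longrightarrow> J = {0} \<or> J = S"
    by (rule ex_minimal_ideal) blast
  let ?T = "\<theta> ` S"
  have T: "tw.ideal ?T"
    using S(1) by (rule ideal_image_twist)
  have minT: "J = {0} \<or> J = ?T" if "tw.ideal J" "J \<subseteq> ?T" for J
  proof -
    have "\<theta> ` J \<subseteq> S"
      using image_mono[OF that(2), of \<theta>] by (simp add: image_twist_twist)
    then have "\<theta> ` J = {0} \<or> \<theta> ` J = S"
      using minS ideal_image_twist[OF that(1)] by blast
    then show ?thesis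
      using image_twist_twist[of J] by (auto simp: endo.linear_0[OF linear_twist])
  qed
  show ?thesis
  proof (cases "S \<inter> ?T = {0}")
    case False
    \<comment> \<open>Applying \<open>\<theta>\<close> to this inclusion makes \<open>S\<close>
      stable, so the minimal ideal is the whole algebra.\<close>
    then have "S \<subseteq> ?T"
      using minS[OF tw.ideal_Int[OF S(1) T]] by blast
    then have "\<theta> ` S \<subseteq> S"
      using image_mono[of S ?T \<theta>] by (simp add: image_twist_twist)
    then have "S = UNIV"
      using stable_ideal_trivial[OF S(1)] S(2) by blast
    then have "simple_lie_algebra scale UNIV tw"
      using minS tw_nonzero by unfold_locales auto
    then show ?thesis by blast
  next
    case disjoint: True
    have subS: "subspace S" and subT: "subspace ?T"
      using S(1) T by (simp_all add: tw.ideal_UNIV_iff)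
    have ST0: "tw s t = 0" if "s \<in> S" "t \<in> ?T" for s t
    proof -
      have "tw s t \<in> S" "tw s t \<in> ?T"
        using that S(1) tw.ideal_br_right[OF T] by (simp_all add: tw.ideal_UNIV_iff)
      then show ?thesis using disjoint by blast
    qed
    let ?W = "{x + y | x y. x \<in> S \<and> y \<in> ?T}"
    have "tw.ideal ?W"
      unfolding tw.ideal_UNIV_iff
    proof (intro conjI ballI allI)
      show "subspace ?W"
        using subS subT by (rule subspace_sums)
      fix x y assume "x \<in> ?W"
      then obtain s t where "x = s + t" "s \<in> S" "t \<in> ?T"
        by blast
      then have "tw x y = tw s y + tw t y" "tw s y \<in> S" "tw t y \<in> ?T"
        using S(1) T by (auto simp: tw.br_add_left tw.ideal_UNIV_iff)
      then show "tw x y \<in> ?W" by blast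
    qed
    moreover have "\<theta> x \<in> ?W" if x: "x \<in> ?W" for x
    proof -
      obtain s t where "x = s + \<theta> t" "s \<in> S" "t \<in> S"
        using x by blast
      then have "\<theta> x = t + \<theta> s" "t \<in> S" "\<theta> s \<in> ?T"
        by (auto simp: endo.linear_add[OF linear_twist] involutive add.commute)
      then show ?thesis by blast
    qed
    moreover have "S \<subseteq> ?W"
      using subspace_0[OF subT] by force
    ultimately have W: "?W = UNIV"
      using stable_ideal_trivial[of ?W] S(2) subspace_0[OF subS] by blast
    \<comment> \<open>\<open>S\<close> is not abelian: it commutes with \<open>\<theta>(S)\<close>,
      so otherwise its elements would be central.\<close>
    obtain s s' where s: "s \<in> S" "s' \<in> S" "tw s s' \<noteq> 0"
    proof -
      obtain s where s: "s \<in> S" "s \<noteq> 0"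
        using S(2) subspace_0[OF subS] by blast
      then obtain y where y: "tw s y \<noteq> 0"
        using center_trivial by blast
      obtain s' t where "y = s' + t" "s' \<in> S" "t \<in> ?T"
        using W by blast
      then have "tw s s' \<noteq> 0"
        using y ST0[OF s(1)] by (simp add: tw.br_add_right)
      then show thesis using that s(1) \<open>s' \<in> S\<close> by blast
    qed
    have simpleS: "simple_lie_algebra scale S tw"
    proof -
      interpret S: lie_algebra scale S tw
        using S(1) by (rule lie_algebra_subideal)
      show ?thesis
      proof unfold_locales
        show "\<exists>x\<in>S. \<exists>y\<in>S. tw x y \<noteq> 0"
          using s by blast
        fix J assume J: "S.ideal J"
        \<comment> \<open>As \<open>\<theta>(S)\<close> commutes with \<open>S\<close>, an ideal of
          \<open>S\<close> is an ideal of the whole algebra, and minimality of \<open>S\<close>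
          applies.\<close>
        have "tw x y \<in> J" if x: "x \<in> J" for x y
        proof -
          obtain s t where "y = s + t" "s \<in> S" "t \<in> ?T"
            using W by blast
          moreover have "x \<in> S" "tw x s \<in> J" if "s \<in> S" for s
            using J x that by (auto simp: S.ideal_def)
          ultimately show ?thesis
            using ST0[of x t] by (simp add: tw.br_add_right)
        qed
        then have "tw.ideal J"
          using J by (simp add: S.ideal_def tw.ideal_UNIV_iff)
        then show "J = {0} \<or> J = S"
          using minS J by (simp add: S.ideal_def)
      qed
    qed
    \<comment> \<open>Stated for any minimal nonabelian ideal so as to cover both \<open>S\<close>
      and \<open>\<theta>(S)\<close>.\<close>
    have perfect: "tw.bracket_span M M = M"
      if "tw.ideal M" "\<And>J. tw.ideal J \<Longrightarrow> J \<subseteq> M \<Longrightarrow> J = {0} \<or> J = M" "m \<in> M" "m' \<in> M" "tw m m' \<noteq> 0"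
      for M m m'
    proof -
      have "tw.bracket_span M M \<subseteq> M"
        using that(1) by (intro tw.bracket_span_subset) (auto simp: tw.ideal_UNIV_iff)
      moreover have "tw.bracket_span M M \<noteq> {0}"
        using tw.br_in_bracket_span[OF that(3,4)] that(5) by auto
      ultimately show ?thesis
        using that(2) tw.ideal_bracket_span[OF that(1,1)] by blast
    qed
    have perfectS: "tw.bracket_span S S = S"
      using S(1) minS s by (rule perfect)
    have "tw (\<theta> s) (\<theta> s') \<noteq> 0"
      using s(3) by (metis \<theta>_tw involutive endo.linear_0[OF linear_twist])
    then have perfectT: "tw.bracket_span ?T ?T = ?T"
      using s by (intro perfect[OF T minT]) auto
    have "?T \<noteq> {0}"
      using S(2) image_twist_twist[of S] by (auto simp: endo.linear_0[OF linear_twist])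
    have semisimple: "semisimple_lie_algebra scale UNIV tw"
    proof unfold_locales
      fix I assume I: "tw.ideal I" "tw.solvable I"
      have IS: "I \<inter> S = {0}"
        using I S(1) perfectS S(2) minS by (rule tw.solvable_ideal_Int_minimal_perfect)
      have IT: "I \<inter> ?T = {0}"
        using I T perfectT \<open>?T \<noteq> {0}\<close> minT by (rule tw.solvable_ideal_Int_minimal_perfect)
      \<comment> \<open>A solvable ideal meets both summands trivially, hence commutes with both,
        hence is central.\<close>
      have "x = 0" if x: "x \<in> I" for x
      proof (rule center_trivial)
        fix y
        obtain s t where y: "y = s + t" "s \<in> S" "t \<in> ?T"
          using W by blast
        have "tw x s \<in> I \<inter> S" "tw x t \<in> I \<inter> ?T"
          using x y(2,3) I(1) tw.ideal_br_right[OF S(1)] tw.ideal_br_right[OF T]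
          by (simp_all add: tw.ideal_UNIV_iff)
        then show "tw x y = 0"
          using IS IT by (simp add: y(1) tw.br_add_right)
      qed
      then show "I = {0}"
        using I(1) subspace_0[of I] by (auto simp: tw.ideal_UNIV_iff)
    qed
    have "S \<noteq> UNIV"
      using disjoint \<open>?T \<noteq> {0}\<close> by blast
    then have "\<not> simple_lie_algebra scale UNIV tw"
      using S simple_lie_algebra.no_proper_ideal by blast
    moreover have "tw.direct_sum_of_ideals S ?T"
      using S(1) T disjoint W by (simp add: tw.direct_sum_of_ideals_def)
    ultimately show ?thesis
      using semisimple S(1) simpleS by blast
  qed
qed

end

section \<open>The converse: twisting a simple Lie algebra by an involution\<close>

lemma simple_hom_lie_algebra_of_involution:
  assumes "simple_lie_algebra scale UNIV br" "lie_automorphism scale br \<theta>" "\<theta> \<circ> \<theta> = id"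
  shows "simple_hom_lie_algebra scale (\<lambda>x y. \<theta> (br x y)) \<theta>"
proof -
  interpret simple_lie_algebra scale UNIV br by fact
  interpret endo: vector_space_pair scale scale by unfold_locales
  have lin: "Vector_Spaces.linear scale scale \<theta>" and hom: "\<theta> (br x y) = br (\<theta> x) (\<theta> y)" for x y
    using assms(2) by (auto simp: lie_automorphism_def)
  have inv: "\<theta> (\<theta> x) = x" for x
    using assms(3) by (metis comp_apply id_apply)
  have br_lin_left: "Vector_Spaces.linear scale scale (\<lambda>x. br x y)" for y
    by unfold_locales (simp_all add: br_add_left br_scale_left)
  have br_lin_right: "Vector_Spaces.linear scale scale (\<lambda>y. br x y)" for x
    by unfold_locales (simp_all add: br_add_right br_scale_right)
  interpret hom: hom_lie_algebra scale "\<lambda>x y. \<theta> (br x y)" \<theta>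
  proof unfold_locales
    \<comment> \<open>Each summand is \<open>\<theta>\<close> applied twice to
      \<open>br x (br y z)\<close> or a cyclic variant, so this is the ordinary Jacobi
      identity.\<close>
    show "\<theta> (br (\<theta> x) (\<theta> (br y z))) + \<theta> (br (\<theta> y) (\<theta> (br z x))) + \<theta> (br (\<theta> z) (\<theta> (br x y))) = 0" for x y z
      using jacobi[of x y z] by (simp add: hom inv)
  next
    show "\<theta> (br x y) = - \<theta> (br y x)" for x y
      using br_anticommute[of x y] endo.linear_neg[OF lin] by simp
  qed (simp_all add: endo.linear_add[OF lin] endo.linear_scale[OF lin] br_add_left br_add_right
      br_scale_left br_scale_right)
  show ?thesis
  proof unfold_locales
    show "\<exists>x y. \<theta> (br x y) \<noteq> 0"
      using nonabelian by (metis inv endo.linear_0[OF lin])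
    fix I assume I: "hom.ideal I"
    \<comment> \<open>Stability under \<open>\<theta>\<close> undoes the twist, so a Hom-ideal is an
      ideal of the untwisted algebra.\<close>
    have "br x y \<in> I" if "x \<in> I" for x y
    proof -
      have "\<theta> (\<theta> (br x y)) \<in> I"
        using I that unfolding hom.ideal_def by blast
      then show ?thesis by (simp add: inv)
    qed
    then have "ideal I"
      using I by (simp add: ideal_def hom.ideal_def)
    then show "I = {0} \<or> I = UNIV" by (rule no_proper_ideal)
  qed
qed

theorem theorem6p2:
  fixes scale :: "'k::{alg_closed_field, field_char_0} \<Rightarrow> 'v::ab_group_add \<Rightarrow> 'v"
    and Basis :: "'v set"
  assumes "finite_dimensional_vector_space scale Basis"
  shows
    "(\<forall>(br :: 'v \<Rightarrow> 'v \<Rightarrow> 'v) (\<theta> :: 'v \<Rightarrow> 'v).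
        simple_hom_lie_algebra scale br \<theta> \<and>
        multiplicative_hom_lie_algebra scale br \<theta> \<and>
        involutive_hom_lie_algebra scale br \<theta> \<longrightarrow>
        (let br\<theta> = (\<lambda>x y. \<theta> (br x y));
             B = (\<lambda>x y. finite_dimensional_vector_space.endo_trace scale Basis (br x \<circ> br y))
         in
           lie_algebra scale UNIV br\<theta> \<and>
           (simple_lie_algebra scale UNIV br\<theta> \<or>
            \<not> simple_lie_algebra scale UNIV br\<theta> \<and>
            semisimple_lie_algebra scale UNIV br\<theta> \<and>
            (\<exists>S. lie_algebra.ideal scale UNIV br\<theta> S \<and>
                 simple_lie_algebra scale S br\<theta> \<and>
                 lie_algebra.direct_sum_of_ideals scale UNIV br\<theta> S (\<theta> ` S))) \<and>
           quadratic_structure scale br \<theta> B \<and>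
           (\<forall>x y. B x y =
              finite_dimensional_vector_space.killing_form scale Basis br\<theta> (\<theta> x) y)))
     \<and>
     (\<forall>(br :: 'v \<Rightarrow> 'v \<Rightarrow> 'v) (\<theta> :: 'v \<Rightarrow> 'v).
        simple_lie_algebra scale UNIV br \<and>
        lie_automorphism scale br \<theta> \<and> \<theta> \<circ> \<theta> = id \<longrightarrow>
        simple_hom_lie_algebra scale (\<lambda>x y. \<theta> (br x y)) \<theta>)"
proof (intro conjI allI impI, goal_cases)
  case (1 br \<theta>)
  interpret finite_dimensional_vector_space scale Basis by (rule assms)
  interpret simple_hom_lie_algebra scale br \<theta> using 1 by blast
  interpret multiplicative_hom_lie_algebra scale br \<theta> using 1 by blast
  interpret involutive_hom_lie_algebra scale br \<theta> using 1 by blast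
  interpret simple_involutive_hom_lie_algebra scale Basis br \<theta> ..
  have tw_eq: "(\<lambda>x y. \<theta> (br x y)) = tw"
    by (simp add: fun_eq_iff tw_def)
  show ?case
    unfolding Let_def tw_eq
    using tw.lie_algebra_axioms simple_or_direct_sum quadratic_structure_trace_form
      trace_form_eq_killing_form by blast
next
  case (2 br \<theta>)
  then show ?case
    using simple_hom_lie_algebra_of_involution by blast
qed

end
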